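(* Let $\theta\in(0,1)$. For $\xi<\omega_1$ and $\omega^\xi<\zeta<\omega^{\xi+1}$, $T(\theta,\omega^\xi)\in P^\vee_4(\zeta,1)$, while $(E,T(\theta,\omega^\xi))\notin P^\wedge_2(\omega^\xi+1,1)$, where $E$ denotes the canonical basis of $T(\theta,\omega^\xi)$.
   Context: Schreier families: for families $\mathcal{F},\mathcal{G}$ of finite subsets of $\mathbb{N}$, $\mathcal{F}[\mathcal{G}]$ consists of $\varnothing$ and all unions $\bigcup_{i=1}^sE_i$ with non-empty $E_i\in\mathcal{G}$, $\max E_i<\min E_{i+1}$, $\{\min E_i\}_{i=1}^s\in\mathcal{F}$. $\mathcal{S}_0=\{E:|E|\leqslant1\}$, $\mathcal{S}=\mathcal{S}_1=\{\varnothing\}\cup\{E:|E|\leqslant\min E\}$, $\mathcal{S}_{\xi+1}=\mathcal{S}[\mathcal{S}_\xi]$; for limit $\xi<\omega_1$, $\mathcal{S}_\xi=\{E:\exists n\leqslant\min E,\ E\in\mathcal{S}_{\xi_n+1}\}$ for a fixed sequence $\xi_n\uparrow\xi$ with $\mathcal{S}_{\xi_n+1}\subset\mathcal{S}_{\xi_{n+1}}$; $\mathcal{S}_{\omega_1}$ is the family of all finite subsets of $\mathbb{N}$. Tsirelson-type spaces: for $E\subset\mathbb{N}$ finite and a scalar sequence $x$, $Ex$ is the pointwise product of $x$ with $1_E$. A sequence $(E_i)_{i=1}^s$ of finite sets is $\mathcal{F}$-admissible if $\max E_i<\min E_{i+1}$ for all $i<s$ and $\{\min E_i\}_{i=1}^s\in\mathcal{F}$.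 On the finitely supported scalar sequences $c_{00}$ put $|\cdot|_0=\|\cdot\|_{c_0}$ and $|x|_{n+1}=\max\{|x|_n,\ \sup\{\theta\sum_{i=1}^s|E_ix|_n:(E_i)_{i=1}^s\text{ is }\mathcal{F}\text{-admissible}\}\}$. $T(\theta,\mathcal{F})$ is the completion of $c_{00}$ under the norm $\lim_n|x|_n$, and $T(\theta,\zeta)=T(\theta,\mathcal{S}_\zeta)$. The canonical $c_{00}$ basis is a normalized $1$-unconditional basis of it, regarded as an FDD. Trees: a tree is a set of finite sequences (including $\varnothing$) closed under initial segments. $T'$ is $T$ with its maximal members removed, $d^0(T)=T$, $d^{\xi+1}(T)=(d^\xi(T))'$, $d^\xi(T)=\bigcap_{\zeta<\xi}d^\zeta(T)$ for limit $\xi$, $o(T)=\min\{\xi:d^\xi(T)=\varnothing\}$, with $o(T)=\infty$ (exceeding all ordinals) if no such ordinal exists. $T_1(X,K)$ is the tree of all finite sequences $(x_i)_{i=1}^n$ in the unit ball $B_X$ with $K^{-1}\leqslant\|\sum_{i=1}^na_ix_i\|\leqslant1$ for all $(a_i)_{i=1}^n$ in the unit sphere of $\ell_1^n$; $T_1(X,E,K)$ consists of the members of $T_1(X,K)$ which are block sequences with respect to $E$ (non-zero finitely supported vectors with successive supports); $I_1(X,E,K)=o(T_1(X,E,K))$. An infinite sequence $(x_n)\subset X$ is a $K$-$\ell_1^\xi$ spreading model if $(x_n)_{n\in F}\in T_1(X,K)$ for each $F\in\mathcal{S}_\xi$. $\mathcal{SM}_1(X,K)=\min\{\xi\leqslant\omega_1:X\text{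 admits no }K\text{-}\ell_1^\xi\text{ spreading model}\}$ ($\infty$ if there is no such $\xi$). $P^\vee_4(\xi,1)$ is the class of Banach spaces $X$ with $\mathcal{SM}_1(X,K)>\xi$ for some $K>1$. $P^\wedge_2(\xi,1)$ is the class of pairs $(E,X)$, $E$ an FDD (e.g. a basis) for $X$, with $I_1(X,E,K)>\omega^\xi$ for all $K>1$. *)

theory Defs
  imports
    "HOL-Analysis.Analysis"
    "HOL-Library.Extended"
    "HOL-Library.Sublist"
begin

section \<open>Ordinals\<close>

no_notation elt_set_eq (infix \<open>=o\<close> 50)
unbundle cardinal_syntax

text \<open>
  The order types of the well-orders carried by sets of reals, i.e. the ordinals below the
  successor cardinal of the continuum.  All countable ordinals and \<open>\<omega>\<^sub>1\<close> are among them, and so is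
  the order of every well-founded tree with at most continuum many members, in particular of every
  such tree of finite sequences in a separable normed space.
\<close>

quotient_type ordinal = "real rel" / partial: "\<lambda>r s. r =o s"
proof (rule part_equivpI)
  show "\<exists>r::real rel. r =o r"
    using card_of_refl by blast
  show "symp (\<lambda>r s::real rel. r =o s)"
    by (auto intro: sympI ordIso_symmetric)
  show "transp (\<lambda>r s::real rel. r =o s)"
    by (auto intro: transpI ordIso_transitive)
qed

lemma ordIso_self_iff: "r =o r \<longleftrightarrow> Well_order r"
  using ordIso_reflexive by (auto simp: ordIso_def)

instantiation ordinal :: linorder
begin

lift_definition less_eq_ordinal :: "ordinal \<Rightarrow> ordinal \<Rightarrow> bool"
  is "\<lambda>r s. r \<le>o s"
  by (meson ordIso_ordLeq_trans ordIso_symmetric ordLeq_ordIso_trans)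

lift_definition less_ordinal :: "ordinal \<Rightarrow> ordinal \<Rightarrow> bool"
  is "\<lambda>r s. r <o s"
  by (meson ordIso_ordLess_trans ordIso_symmetric ordLess_ordIso_trans)

instance
proof
  fix x y z :: ordinal
  show "x < y \<longleftrightarrow> x \<le> y \<and> \<not> y \<le> x"
    by transfer (meson not_ordLeq_iff_ordLess ordIso_self_iff ordLess_imp_ordLeq)
  show "x \<le> x"
    by transfer (simp add: ordIso_imp_ordLeq)
  show "x \<le> y \<Longrightarrow> y \<le> z \<Longrightarrow> x \<le> z"
    by transfer (rule ordLeq_transitive)
  show "x \<le> y \<Longrightarrow> y \<le> x \<Longrightarrow> x = y"
    by transfer (simp add: ordIso_iff_ordLeq)
  show "x \<le> y \<or> y \<le> x"
    by transfer (simp add: ordIso_self_iff ordLeq_total)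
qed

end

instance ordinal :: wellorder
proof
  fix P :: "ordinal \<Rightarrow> bool" and a
  assume step: "\<And>x. (\<And>y. y < x \<Longrightarrow> P y) \<Longrightarrow> P x"
  have "\<forall>x. x = abs_ordinal r \<longrightarrow> r =o r \<longrightarrow> P x" for r
  proof (induction r rule: wf_induct[OF wf_ordLess])
    case (1 r)
    show ?case
    proof (intro allI impI)
      fix x assume x: "x = abs_ordinal r" and r: "r =o r"
      show "P x"
      proof (rule step)
        fix y assume "y < x"
        obtain s where s: "s =o s" "y = abs_ordinal s"
          using Quotient3_rep_reflp[OF Quotient3_ordinal, of y]
            Quotient3_abs_rep[OF Quotient3_ordinal, of y] by metis
        with \<open>y < x\<close> x r have "s <o r"
          by (simp add: less_ordinal.abs_eq)
        with 1 s show "P y" by blast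
      qed
    qed
  qed
  then show "P a"
    using Quotient3_rep_reflp[OF Quotient3_ordinal, of a]
      Quotient3_abs_rep[OF Quotient3_ordinal, of a] by metis
qed

lemma ordinal_cases:
  obtains r where "Well_order r" "\<alpha> = abs_ordinal r"
  using Quotient3_rep_reflp[OF Quotient3_ordinal, of \<alpha>]
    Quotient3_abs_rep[OF Quotient3_ordinal, of \<alpha>] ordIso_self_iff by metis

lemma abs_ordinal_less_iff:
  "Well_order r \<Longrightarrow> Well_order s \<Longrightarrow> abs_ordinal r < abs_ordinal s \<longleftrightarrow> r <o s"
  by (simp add: less_ordinal.abs_eq ordIso_self_iff)

lemma ordinal_bounded:
  fixes A :: "ordinal set"
  assumes "|A| \<le>o |UNIV :: real set|"
  shows "\<exists>\<beta>. \<forall>\<alpha>\<in>A. \<alpha> < \<beta>"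
proof -
  let ?c = "|UNIV :: real set|"
  define s where "s = cardSuc ?c"
  have cs: "Card_order s" and ws: "Well_order s" and cless: "?c <o s"
    by (auto simp: s_def cardSuc_Card_order cardSuc_Well_order cardSuc_greater card_of_Card_order)
  have inf: "infinite (UNIV :: real set)"
    by (rule infinite_UNIV_char_0)
  have under_le: "|underS s a| \<le>o ?c" if "a \<in> Field s" for a
    using card_of_underS[OF cs that] cardSuc_ordLeq_ordLess[where r = ?c and r' = "|underS s a|"]
    by (simp add: s_def card_of_Card_order)
  have "\<exists>a. a \<in> Field s \<and> (\<forall>r. Well_order r \<and> \<alpha> = abs_ordinal r \<longrightarrow> r =o Restr s (underS s a))" for \<alpha>
  proof -
    obtain r where r: "Well_order r" "\<alpha> = abs_ordinal r"
      by (rule ordinal_cases)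
    have "r <o s"
    proof (rule ccontr)
      assume "\<not> r <o s"
      then have "s \<le>o r"
        using r ws not_ordLess_iff_ordLeq by blast
      then have "|Field s| \<le>o |Field r|"
        by (rule card_of_mono2)
      also have "|Field r| \<le>o ?c"
        by (rule card_of_mono1) simp
      finally have "|Field s| \<le>o ?c" .
      moreover have "|Field s| =o s"
        using cs card_of_Field_ordIso by blast
      ultimately have "s \<le>o ?c"
        using ordIso_ordLeq_trans ordIso_symmetric by blast
      then show False
        using cless not_ordLess_ordLeq by blast
    qed
    then obtain a where a: "a \<in> Field s" "r =o Restr s (underS s a)"
      using ordLess_iff_ordIso_Restr[OF ws r(1)] by blast
    have "r' =o Restr s (underS s a)" if "Well_order r'" "\<alpha> = abs_ordinal r'" for r'
    proof -
      have "r' =o r"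
        using that r Quotient3_rel[OF Quotient3_ordinal, of r' r]
        by (simp add: ordIso_self_iff)
      then show ?thesis
        using a ordIso_transitive by blast
    qed
    with a show ?thesis by blast
  qed
  then obtain f where f: "\<And>\<alpha>. f \<alpha> \<in> Field s"
    "\<And>\<alpha> r. Well_order r \<Longrightarrow> \<alpha> = abs_ordinal r \<Longrightarrow> r =o Restr s (underS s (f \<alpha>))"
    by metis
  have "|\<Union>\<alpha>\<in>A. underS s (f \<alpha>)| \<le>o ?c"
    by (rule card_of_UNION_ordLeq_infinite[OF inf assms]) (use under_le f(1) in auto)
  moreover have "|f ` A| \<le>o ?c"
    by (rule ordLeq_transitive[OF card_of_image assms])
  ultimately have "|(\<Union>\<alpha>\<in>A. underS s (f \<alpha>)) \<union> f ` A| \<le>o ?c"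
    by (intro card_of_Un_ordLeq_infinite_Field[OF _ _ _ card_of_Card_order]) (use inf in \<open>auto simp: Field_card_of\<close>)
  moreover have "\<not> |Field s| \<le>o ?c"
  proof
    assume "|Field s| \<le>o ?c"
    with card_of_Field_ordIso[OF cs] have "s \<le>o ?c"
      by (meson ordIso_ordLeq_trans ordIso_symmetric)
    with cless show False
      using not_ordLess_ordLeq by blast
  qed
  ultimately have "\<not> Field s \<subseteq> (\<Union>\<alpha>\<in>A. underS s (f \<alpha>)) \<union> f ` A"
    using card_of_mono1 ordLeq_transitive by meson
  then obtain b where b: "b \<in> Field s" "\<And>\<alpha>. \<alpha> \<in> A \<Longrightarrow> b \<notin> underS s (f \<alpha>)" "b \<notin> f ` A"
    by blast
  have lt: "f \<alpha> \<in> underS s b" if "\<alpha> \<in> A" for \<alpha>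
  proof -
    have "f \<alpha> \<noteq> b"
      using b(3) that by blast
    moreover have "(b, f \<alpha>) \<in> s \<or> (f \<alpha>, b) \<in> s"
      using ws b(1) f(1)[of \<alpha>] calculation
      unfolding well_order_on_def linear_order_on_def total_on_def by metis
    ultimately show ?thesis
      using b(2)[OF that] unfolding underS_def by blast
  qed
  let ?t = "Restr s (underS s b)"
  have wt: "Well_order ?t"
    by (rule Well_order_Restr[OF ws])
  have "|Field ?t| \<le>o ?c"
    by (rule ordLeq_transitive[OF card_of_mono1[OF Field_Restr_subset] under_le[OF b(1)]])
  then obtain g :: "_ \<Rightarrow> real" where g: "inj_on g (Field ?t)"
    using card_of_ordLeq[of "Field ?t" "UNIV :: real set"] by auto
  let ?r = "dir_image ?t g"
  have r: "Well_order ?r" "?t =o ?r"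
    using Well_order_dir_image[OF wt g] dir_image_ordIso[OF wt g] by auto
  have "\<alpha> < abs_ordinal ?r" if "\<alpha> \<in> A" for \<alpha>
  proof -
    obtain q where q: "Well_order q" "\<alpha> = abs_ordinal q"
      by (rule ordinal_cases)
    have o: "wo_rel.ofilter s (underS s x)" for x
      by (rule wo_rel.underS_ofilter) (simp add: wo_rel_def ws)
    have "underS s (f \<alpha>) \<subset> underS s b"
    proof
      have tr: "trans s" "antisym s"
        using ws unfolding well_order_on_def linear_order_on_def partial_order_on_def
          preorder_on_def by auto
      show "underS s (f \<alpha>) \<subseteq> underS s b"
        using lt[OF that] tr unfolding underS_def by (auto dest: transD antisymD)
      show "underS s (f \<alpha>) \<noteq> underS s b"
        using lt[OF that] unfolding underS_def by blast
    qed
    then have "Restr s (underS s (f \<alpha>)) <o ?t"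
      by (simp add: ofilter_subset_ordLess[OF ws o o])
    then have "q <o ?r"
      by (rule ordIso_ordLess_trans[OF f(2)[OF q] ordLess_ordIso_trans[OF _ r(2)]])
    then show ?thesis
      using q r(1) abs_ordinal_less_iff by blast
  qed
  then show ?thesis by blast
qed

lemma ordinal_no_max: "\<exists>\<beta>. (\<alpha>::ordinal) < \<beta>"
proof -
  have "|{\<alpha>}| \<le>o |UNIV :: real set|"
    by (rule card_of_ordLeqI[of "\<lambda>_. 0"]) auto
  then show ?thesis
    using ordinal_bounded[of "{\<alpha>}"] by auto
qed

unbundle no cardinal_syntax

subsection \<open>Transfinite recursion and arithmetic\<close>

definition osuc :: "ordinal \<Rightarrow> ordinal"
  where "osuc \<alpha> = (LEAST \<beta>. \<alpha> < \<beta>)"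

definition osup :: "ordinal set \<Rightarrow> ordinal"
  where "osup A = (LEAST \<beta>. \<forall>\<alpha>\<in>A. \<alpha> \<le> \<beta>)"

instantiation ordinal :: "{zero, one}"
begin
definition zero_ordinal_def: "(0::ordinal) = (LEAST \<alpha>. True)"
definition one_ordinal_def: "(1::ordinal) = osuc 0"
instance ..
end

definition limit_ord :: "ordinal \<Rightarrow> bool"
  where "limit_ord \<delta> \<longleftrightarrow> \<delta> \<noteq> 0 \<and> \<delta> \<notin> range osuc"

text \<open>
  \<open>ord_rec z s l\<close> is the function \<open>F\<close> with \<open>F 0 = z\<close>, \<open>F (\<alpha> + 1) = s (F \<alpha>)\<close> and
  \<open>F \<delta> = l \<delta> F\<close> at limits, where \<open>l \<delta> F\<close> may only depend on the values of \<open>F\<close> below \<open>\<delta>\<close>.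
\<close>

definition ord_rec ::
  "'b \<Rightarrow> ('b \<Rightarrow> 'b) \<Rightarrow> (ordinal \<Rightarrow> (ordinal \<Rightarrow> 'b) \<Rightarrow> 'b) \<Rightarrow> ordinal \<Rightarrow> 'b"
  where "ord_rec z s l = wfrec {(\<alpha>, \<beta>). \<alpha> < \<beta>}
    (\<lambda>f \<alpha>. if \<alpha> = 0 then z
           else if \<alpha> \<in> range osuc then s (f (THE \<beta>. \<alpha> = osuc \<beta>))
           else l \<alpha> f)"

lemma less_osuc: "\<alpha> < osuc \<alpha>"
  unfolding osuc_def using ordinal_no_max LeastI_ex by metis

lemma osuc_le_iff: "osuc \<alpha> \<le> \<beta> \<longleftrightarrow> \<alpha> < \<beta>"
  using less_osuc[of \<alpha>] Least_le[of "\<lambda>\<beta>. \<alpha> < \<beta>" \<beta>] by (auto simp: osuc_def)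

lemma osuc_inject: "osuc \<alpha> = osuc \<beta> \<longleftrightarrow> \<alpha> = \<beta>"
  by (metis less_osuc linorder_neqE osuc_le_iff leD)

lemma zero_le_ordinal: "(0::ordinal) \<le> \<alpha>"
  unfolding zero_ordinal_def by (simp add: Least_le)

lemma osuc_nonzero: "osuc \<alpha> \<noteq> 0"
  using less_osuc zero_le_ordinal leD by metis

lemma ord_rec_0: "ord_rec z s l 0 = z"
  unfolding ord_rec_def by (subst wfrec[OF wf]) simp

lemma ord_rec_osuc: "ord_rec z s l (osuc \<alpha>) = s (ord_rec z s l \<alpha>)"
  unfolding ord_rec_def
  by (subst wfrec[OF wf]) (simp add: osuc_nonzero osuc_inject cut_apply less_osuc)

lemma ord_rec_limit:
  assumes "limit_ord \<delta>" and "\<And>f g. (\<And>\<beta>. \<beta> < \<delta> \<Longrightarrow> f \<beta> = g \<beta>) \<Longrightarrow> l \<delta> f = l \<delta> g"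
  shows "ord_rec z s l \<delta> = l \<delta> (ord_rec z s l)"
proof -
  have "ord_rec z s l \<delta> = l \<delta> (cut (ord_rec z s l) {(\<alpha>, \<beta>). \<alpha> < \<beta>} \<delta>)"
    using assms(1) unfolding limit_ord_def ord_rec_def by (subst wfrec[OF wf]) auto
  also have "\<dots> = l \<delta> (ord_rec z s l)"
    by (rule assms(2)) (simp add: cut_apply)
  finally show ?thesis .
qed

instantiation ordinal :: "{plus, times}"
begin

definition plus_ordinal_def:
  "(\<alpha>::ordinal) + \<beta> = ord_rec \<alpha> osuc (\<lambda>\<delta> f. osup (f ` {..<\<delta>})) \<beta>"

definition times_ordinal_def:
  "(\<alpha>::ordinal) * \<beta> = ord_rec 0 (\<lambda>\<gamma>. \<gamma> + \<alpha>) (\<lambda>\<delta> f. osup (f ` {..<\<delta>})) \<beta>"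

instance ..

end

lemma ordinal_add_1: "\<alpha> + 1 = osuc \<alpha>"
  by (simp add: plus_ordinal_def one_ordinal_def ord_rec_0 ord_rec_osuc)

definition omega :: ordinal
  where "omega = (LEAST \<delta>. limit_ord \<delta>)"

definition omega_pow :: "ordinal \<Rightarrow> ordinal"
  where "omega_pow = ord_rec 1 (\<lambda>\<gamma>. \<gamma> * omega) (\<lambda>\<delta> f. osup (f ` {..<\<delta>}))"

definition omega1 :: ordinal
  where "omega1 = (LEAST \<alpha>. uncountable {..<\<alpha>})"


section \<open>Schreier families\<close>

text \<open>
  Here \<open>\<nat>\<close> is \<open>{1, 2, \<dots>}\<close>: finite sets of positive integers are encoded as finite
  sets of type \<^typ>\<open>nat set\<close> that do not contain \<open>0\<close>.
\<close>

definition fin_pos :: "nat set set"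
  where "fin_pos = {E. finite E \<and> 0 \<notin> E}"

text \<open>Lists \<open>E\<^sub>1, \<dots>, E\<^sub>s\<close> of non-empty finite sets with successive members and minima in \<open>F\<close>.\<close>

definition admissible :: "nat set set \<Rightarrow> nat set list \<Rightarrow> bool"
  where "admissible F Es \<longleftrightarrow>
    (\<forall>E\<in>set Es. E \<in> fin_pos \<and> E \<noteq> {}) \<and>
    (\<forall>i. Suc i < length Es \<longrightarrow> Max (Es ! i) < Min (Es ! Suc i)) \<and>
    Min ` set Es \<in> F"

definition bracket :: "nat set set \<Rightarrow> nat set set \<Rightarrow> nat set set"
  where "bracket F G = {{}} \<union> {\<Union>(set Es) | Es. admissible F Es \<and> set Es \<subseteq> G}"

definition schreier0 :: "nat set set"
  where "schreier0 = {E \<in> fin_pos. card E \<le> 1}"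

definition schreier1 :: "nat set set"
  where "schreier1 = {{}} \<union> {E \<in> fin_pos. E \<noteq> {} \<and> card E \<le> Min E}"

text \<open>\<open>\<sigma> \<delta> 1, \<sigma> \<delta> 2, \<dots>\<close> is the sequence chosen for the limit ordinal \<open>\<delta>\<close>.\<close>

definition schreier :: "(ordinal \<Rightarrow> nat \<Rightarrow> ordinal) \<Rightarrow> ordinal \<Rightarrow> nat set set"
  where "schreier \<sigma> \<xi> =
    (if \<xi> < omega1 then
       ord_rec schreier0 (bracket schreier1)
         (\<lambda>\<delta> f. {{}} \<union> {E \<in> fin_pos. E \<noteq> {} \<and> (\<exists>n\<ge>1. n \<le> Min E \<and> E \<in> f (\<sigma> \<delta> n + 1))}) \<xi>
     else fin_pos)"

definition schreier_choice :: "(ordinal \<Rightarrow> nat \<Rightarrow> ordinal) \<Rightarrow> bool"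
  where "schreier_choice \<sigma> \<longleftrightarrow>
    (\<forall>\<delta>. limit_ord \<delta> \<and> \<delta> < omega1 \<longrightarrow>
      (\<forall>n\<ge>1. \<sigma> \<delta> n < \<sigma> \<delta> (Suc n) \<and> \<sigma> \<delta> n < \<delta>) \<and>
      (\<forall>\<beta><\<delta>. \<exists>n\<ge>1. \<beta> < \<sigma> \<delta> n) \<and>
      (\<forall>n\<ge>1. schreier \<sigma> (\<sigma> \<delta> n + 1) \<subseteq> schreier \<sigma> (\<sigma> \<delta> (Suc n))))"

lemma bracket_schreier0: "bracket schreier1 schreier0 = schreier1"
proof (intro equalityI subsetI)
  fix E assume "E \<in> bracket schreier1 schreier0"
  then consider "E = {}" | Es where "E = \<Union>(set Es)" "admissible schreier1 Es" "set Es \<subseteq> schreier0"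
    unfolding bracket_def by blast
  then show "E \<in> schreier1"
  proof cases
    case 2
    have "A = {Min A}" if "A \<in> set Es" for A
    proof -
      have "finite A" "A \<noteq> {}" "card A \<le> 1"
        using that 2 by (auto simp: admissible_def fin_pos_def schreier0_def)
      then have "card A = 1"
        using card_gt_0_iff[of A] by linarith
      then show ?thesis
        by (metis Min_singleton card_1_singletonE)
    qed
    then have "E = Min ` set Es"
      using 2(1) by (auto simp: set_eq_iff)
    then show ?thesis
      using 2(2) by (simp add: admissible_def)
  qed (simp add: schreier1_def)
next
  fix E assume E: "E \<in> schreier1"
  define Es where "Es = map (\<lambda>n. {n}) (sorted_list_of_set E)"
  have fin: "finite E" "0 \<notin> E"
    using E by (auto simp: schreier1_def fin_pos_def)
  have st: "set Es = (\<lambda>n. {n}) ` E"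
    using fin by (simp add: Es_def)
  then have "E = \<Union>(set Es)" "set Es \<subseteq> schreier0" "Min ` set Es = E"
    using fin by (auto simp: schreier0_def fin_pos_def image_image)
  moreover have "sorted_list_of_set E ! i < sorted_list_of_set E ! Suc i" if "Suc i < length Es" for i
    using that strict_sorted_list_of_set[of E] by (auto simp: Es_def sorted_wrt_iff_nth_less)
  ultimately have "admissible schreier1 Es"
    using E fin st unfolding admissible_def by (auto simp: Es_def fin_pos_def)
  with \<open>E = \<Union>(set Es)\<close> \<open>set Es \<subseteq> schreier0\<close> show "E \<in> bracket schreier1 schreier0"
    unfolding bracket_def by blast
qed


section \<open>Normed spaces over the real or complex scalars\<close>

text \<open>
  The scalar field is a type \<^typ>\<open>'k::real_normed_field\<close>; by the Gelfand--Mazur theorem this is \<open>\<real>\<close>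
  or \<open>\<complex>\<close>.  A normed space over it is a subspace \<open>X\<close> of a type \<^typ>\<open>'x::real_normed_vector\<close> with a
  scalar multiplication \<open>smul\<close> for which the norm is absolutely homogeneous.
\<close>

definition normed_scaling :: "('k::real_normed_field \<Rightarrow> 'x::real_normed_vector \<Rightarrow> 'x) \<Rightarrow> bool"
  where "normed_scaling smul \<longleftrightarrow>
    vector_space smul \<and> (\<forall>c x. norm (smul c x) = norm c * norm x)"

definition banach_space :: "('k::real_normed_field \<Rightarrow> 'x::real_normed_vector \<Rightarrow> 'x) \<Rightarrow> 'x set \<Rightarrow> bool"
  where "banach_space smul X \<longleftrightarrow>
    normed_scaling smul \<and> module.subspace smul X \<and> complete X"

text \<open>
  A finite-dimensional decomposition \<open>(E\<^sub>n)\<^sub>n\<^sub>\<ge>\<^sub>1\<close> of \<open>X\<close>; the unused index \<open>0\<close> is given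
  the zero subspace.
\<close>

definition fdd :: "('k::real_normed_field \<Rightarrow> 'x::real_normed_vector \<Rightarrow> 'x) \<Rightarrow> (nat \<Rightarrow> 'x set) \<Rightarrow> 'x set \<Rightarrow> bool"
  where "fdd smul E X \<longleftrightarrow>
    E 0 = {0} \<and>
    (\<forall>n. \<exists>B. finite B \<and> E n = module.span smul B) \<and>
    (\<forall>n. E n \<subseteq> X) \<and>
    (\<forall>x\<in>X. \<exists>!y. (\<forall>n. y n \<in> E n) \<and> y sums x)"

definition fdd_supp :: "(nat \<Rightarrow> 'x::real_normed_vector set) \<Rightarrow> 'x \<Rightarrow> nat set"
  where "fdd_supp E x = {n. (THE y. (\<forall>n. y n \<in> E n) \<and> y sums x) n \<noteq> 0}"

definition block_sequence :: "(nat \<Rightarrow> 'x::real_normed_vector set) \<Rightarrow> 'x list \<Rightarrow> bool"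
  where "block_sequence E xs \<longleftrightarrow>
    (\<forall>x\<in>set xs. x \<noteq> 0 \<and> finite (fdd_supp E x)) \<and>
    (\<forall>i. Suc i < length xs \<longrightarrow> Max (fdd_supp E (xs ! i)) < Min (fdd_supp E (xs ! Suc i)))"


section \<open>Tsirelson-type spaces\<close>

text \<open>Scalar sequences are indexed by the positive integers; the coordinate \<open>0\<close> is fixed to be \<open>0\<close>.\<close>

definition c00 :: "(nat \<Rightarrow> 'k::real_normed_field) set"
  where "c00 = {x. finite {i. x i \<noteq> 0} \<and> x 0 = 0}"

definition restr :: "nat set \<Rightarrow> (nat \<Rightarrow> 'k::real_normed_field) \<Rightarrow> nat \<Rightarrow> 'k"
  where "restr E x = (\<lambda>i. if i \<in> E then x i else 0)"

primrec tsirelson_approx ::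
  "real \<Rightarrow> nat set set \<Rightarrow> nat \<Rightarrow> (nat \<Rightarrow> 'k::real_normed_field) \<Rightarrow> real"
  where
    "tsirelson_approx \<theta> F 0 x = (SUP i. norm (x i))"
  | "tsirelson_approx \<theta> F (Suc n) x =
       max (tsirelson_approx \<theta> F n x)
         (SUP Es\<in>{Es. admissible F Es}. \<theta> * (\<Sum>E\<leftarrow>Es. tsirelson_approx \<theta> F n (restr E x)))"

definition tsirelson_norm :: "real \<Rightarrow> nat set set \<Rightarrow> (nat \<Rightarrow> 'k::real_normed_field) \<Rightarrow> real"
  where "tsirelson_norm \<theta> F x = lim (\<lambda>n. tsirelson_approx \<theta> F n x)"

text \<open>
  \<open>X\<close> together with \<open>\<iota>\<close> is a completion of \<^const>\<open>c00\<close> normed by \<open>N\<close>: a Banach space containing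
  an isometric linear copy of \<^const>\<open>c00\<close> as a dense subspace.
\<close>

definition completion_of_c00 ::
  "('k::real_normed_field \<Rightarrow> 'x::real_normed_vector \<Rightarrow> 'x) \<Rightarrow> ((nat \<Rightarrow> 'k) \<Rightarrow> real)
    \<Rightarrow> ((nat \<Rightarrow> 'k) \<Rightarrow> 'x) \<Rightarrow> 'x set \<Rightarrow> bool"
  where "completion_of_c00 smul N \<iota> X \<longleftrightarrow>
    banach_space smul X \<and>
    (\<forall>x\<in>c00. \<forall>y\<in>c00. \<iota> (\<lambda>i. x i + y i) = \<iota> x + \<iota> y) \<and>
    (\<forall>c. \<forall>x\<in>c00. \<iota> (\<lambda>i. c * x i) = smul c (\<iota> x)) \<and>
    (\<forall>x\<in>c00. norm (\<iota> x) = N x) \<and>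
    \<iota> ` c00 \<subseteq> X \<and> X \<subseteq> closure (\<iota> ` c00)"

definition is_tsirelson_space ::
  "('k::real_normed_field \<Rightarrow> 'x::real_normed_vector \<Rightarrow> 'x) \<Rightarrow> (ordinal \<Rightarrow> nat \<Rightarrow> ordinal)
    \<Rightarrow> real \<Rightarrow> ordinal \<Rightarrow> ((nat \<Rightarrow> 'k) \<Rightarrow> 'x) \<Rightarrow> 'x set \<Rightarrow> bool"
  where "is_tsirelson_space smul \<sigma> \<theta> \<zeta> \<iota> X \<longleftrightarrow>
    completion_of_c00 smul (tsirelson_norm \<theta> (schreier \<sigma> \<zeta>)) \<iota> X"

definition canonical_basis :: "((nat \<Rightarrow> 'k::real_normed_field) \<Rightarrow> 'x) \<Rightarrow> nat \<Rightarrow> 'x"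
  where "canonical_basis \<iota> n = \<iota> (\<lambda>i. if i = n then 1 else 0)"

definition basis_fdd ::
  "('k::real_normed_field \<Rightarrow> 'x::real_normed_vector \<Rightarrow> 'x) \<Rightarrow> (nat \<Rightarrow> 'x) \<Rightarrow> nat \<Rightarrow> 'x set"
  where "basis_fdd smul e n = (if n = 0 then {0} else range (\<lambda>c. smul c (e n)))"


section \<open>Trees and their orders\<close>

definition tree_derivative :: "'a list set \<Rightarrow> 'a list set"
  where "tree_derivative T = T - {t \<in> T. \<not> (\<exists>s\<in>T. strict_prefix t s)}"

definition tree_derivatives :: "ordinal \<Rightarrow> 'a list set \<Rightarrow> 'a list set"
  where "tree_derivatives \<xi> T = ord_rec T tree_derivative (\<lambda>\<delta> f. \<Inter>\<zeta>\<in>{..<\<delta>}. f \<zeta>) \<xi>"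

definition tree_order :: "'a list set \<Rightarrow> ordinal extended"
  where "tree_order T =
    (if \<exists>\<xi>. tree_derivatives \<xi> T = {} then Fin (LEAST \<xi>. tree_derivatives \<xi> T = {}) else \<infinity>)"


section \<open>The \<open>\<ell>\<^sub>1\<close> index and \<open>\<ell>\<^sub>1\<close> spreading models\<close>

definition l1_tree ::
  "('k::real_normed_field \<Rightarrow> 'x::real_normed_vector \<Rightarrow> 'x) \<Rightarrow> 'x set \<Rightarrow> real \<Rightarrow> 'x list set"
  where "l1_tree smul X K =
    {xs. set xs \<subseteq> X \<and> (\<forall>x\<in>set xs. norm x \<le> 1) \<and>
      (\<forall>a :: nat \<Rightarrow> 'k. (\<Sum>i<length xs. norm (a i)) = 1 \<longrightarrow>
        1 / K \<le> norm (\<Sum>i<length xs. smul (a i) (xs ! i)) \<and>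
        norm (\<Sum>i<length xs. smul (a i) (xs ! i)) \<le> 1)}"

definition l1_block_tree ::
  "('k::real_normed_field \<Rightarrow> 'x::real_normed_vector \<Rightarrow> 'x) \<Rightarrow> 'x set \<Rightarrow> (nat \<Rightarrow> 'x set) \<Rightarrow> real
    \<Rightarrow> 'x list set"
  where "l1_block_tree smul X E K = {xs \<in> l1_tree smul X K. block_sequence E xs}"

definition l1_block_index ::
  "('k::real_normed_field \<Rightarrow> 'x::real_normed_vector \<Rightarrow> 'x) \<Rightarrow> 'x set \<Rightarrow> (nat \<Rightarrow> 'x set) \<Rightarrow> real
    \<Rightarrow> ordinal extended"
  where "l1_block_index smul X E K = tree_order (l1_block_tree smul X E K)"

text \<open>The terms of the sequence are \<open>x 1, x 2, \<dots>\<close>; the value \<open>x 0\<close> plays no role.\<close>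

definition l1_spreading_model ::
  "('k::real_normed_field \<Rightarrow> 'x::real_normed_vector \<Rightarrow> 'x) \<Rightarrow> (ordinal \<Rightarrow> nat \<Rightarrow> ordinal)
    \<Rightarrow> 'x set \<Rightarrow> real \<Rightarrow> ordinal \<Rightarrow> (nat \<Rightarrow> 'x) \<Rightarrow> bool"
  where "l1_spreading_model smul \<sigma> X K \<xi> x \<longleftrightarrow>
    (\<forall>n\<ge>1. x n \<in> X) \<and>
    (\<forall>F\<in>schreier \<sigma> \<xi>. map x (sorted_list_of_set F) \<in> l1_tree smul X K)"

definition SM1 ::
  "('k::real_normed_field \<Rightarrow> 'x::real_normed_vector \<Rightarrow> 'x) \<Rightarrow> (ordinal \<Rightarrow> nat \<Rightarrow> ordinal)
    \<Rightarrow> 'x set \<Rightarrow> real \<Rightarrow> ordinal extended"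
  where "SM1 smul \<sigma> X K =
    (if \<exists>\<xi>\<le>omega1. \<nexists>x. l1_spreading_model smul \<sigma> X K \<xi> x
     then Fin (LEAST \<xi>. \<xi> \<le> omega1 \<and> (\<nexists>x. l1_spreading_model smul \<sigma> X K \<xi> x))
     else \<infinity>)"

definition P4_vee ::
  "('k::real_normed_field \<Rightarrow> 'x::real_normed_vector \<Rightarrow> 'x) \<Rightarrow> (ordinal \<Rightarrow> nat \<Rightarrow> ordinal)
    \<Rightarrow> ordinal \<Rightarrow> 'x set set"
  where "P4_vee smul \<sigma> \<xi> =
    {X. banach_space smul X \<and> (\<exists>K>1. SM1 smul \<sigma> X K > Fin \<xi>)}"

definition P2_wedge ::
  "('k::real_normed_field \<Rightarrow> 'x::real_normed_vector \<Rightarrow> 'x) \<Rightarrow> ordinal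
    \<Rightarrow> ((nat \<Rightarrow> 'x set) \<times> 'x set) set"
  where "P2_wedge smul \<xi> =
    {(E, X). banach_space smul X \<and> fdd smul E X \<and>
      (\<forall>K>1. l1_block_index smul X E K > Fin (omega_pow \<xi>))}"

end

theory Submission
  imports Defs
begin

text \<open>
  Write \<open>\<alpha> = \<omega>\<^sup>\<xi>\<close> and \<open>\<S>\<^sub>\<alpha>\<close> for the Schreier family of index \<open>\<alpha>\<close>.  The two halves of the statement are
  a lower and an upper estimate for the norm \<open>\<parallel>\<cdot>\<parallel>\<close> of \<open>T(\<theta>, \<alpha>)\<close>.

  Lower estimate.  By the definition of the norm, vectors supported on a member of \<open>\<S>\<^sub>\<alpha>\<close> satisfy
  \<open>\<parallel>x\<parallel> \<ge> \<theta> \<parallel>x\<parallel>\<^sub>1\<close>, and iterating this \<open>n\<close> times gives \<open>\<parallel>x\<parallel> \<ge> \<theta>\<^sup>n \<parallel>x\<parallel>\<^sub>1\<close> on members of the \<open>n\<close>-fold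
  bracket \<open>\<S>\<^sub>\<alpha>[\<S>\<^sub>\<alpha>[\<dots>]]\<close> (\<open>iterated_bracket_lower_bound\<close>).  An ordinal below \<open>\<omega>\<^bsup>\<xi>+1\<^esup>\<close> is below some
  \<open>\<alpha> \<cdot> n\<close>, and \<open>\<S>\<^bsub>\<beta>+\<alpha>\<^esub>\<close> is carried into \<open>\<S>\<^sub>\<alpha>[\<S>\<^sub>\<beta>]\<close> by a strictly increasing map of the positive integers
  (\<open>embeds_Sch_add\<close>), so that for every \<open>\<eta> \<le> \<alpha> \<cdot> n\<close> some subsequence of the basis is a
  \<open>\<theta>\<^bsup>-n\<^esup>\<close>-\<open>\<ell>\<^sub>1\<^sup>\<eta>\<close> spreading model, with a constant that does not depend on \<open>\<eta>\<close>.

  Upper estimate.  Let \<open>x = \<Sum>\<^sub>i a\<^sub>i x\<^sub>i\<close> be a convex combination of a block sequence in the unit ball.  In an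
  admissible family \<open>(E\<^sub>j)\<close>, the indices \<open>i\<close> for which at least two of the \<open>E\<^sub>j\<close> meet the support of \<open>x\<^sub>i\<close>
  form, in terms of \<open>max supp x\<^sub>i\<close>, a member of \<open>\<S>\<^sub>\<alpha>\<close>: in the range of each such \<open>x\<^sub>i\<close> lies the minimum of
  some \<open>E\<^sub>j\<close>, and \<open>\<S>\<^sub>\<alpha>\<close> is closed under subsets and under moving points to the right.  Every other \<open>x\<^sub>i\<close> contributes at most \<open>\<theta> a\<^sub>i\<close>.  Hence \<open>\<parallel>x\<parallel> \<le> \<delta> + \<theta>\<close> as soon as \<open>\<delta>\<close> bounds the weight
  that \<open>(a\<^sub>i)\<close> gives to any member of \<open>\<S>\<^sub>\<alpha>\<close> (\<open>block_norm_upper_bound\<close>).  A tree of rank above \<open>\<omega>\<^bsup>\<alpha>+1\<^esup>\<close> has a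
  branch with such weights for every \<open>\<delta> > 0\<close>: they are repeated averages, constructed by transfinite
  induction on \<open>\<alpha>\<close> (\<open>small_averages_Sch\<close>).  If \<open>1/K > \<theta>\<close>, the block tree for the constant
  \<open>K\<close> therefore has order at most \<open>\<omega>\<^bsup>\<alpha>+1\<^esup>\<close>.
\<close>

section \<open>Ordinal arithmetic\<close>

unbundle cardinal_syntax

lemma card_initial_segment: "|{..<\<delta>::ordinal}| \<le>o |UNIV :: real set|"
proof -
  obtain r where r: "Well_order r" "\<delta> = abs_ordinal r"
    by (rule ordinal_cases)
  have "\<exists>a q. Well_order q \<and> \<alpha> = abs_ordinal q \<and> q =o Restr r (underS r a)" if "\<alpha> < \<delta>" for \<alpha>
  proof -
    obtain q where q: "Well_order q" "\<alpha> = abs_ordinal q"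
      by (rule ordinal_cases)
    with that r have "q <o r"
      using abs_ordinal_less_iff by blast
    then show ?thesis
      using ordLess_iff_ordIso_Restr[OF r(1) q(1)] q by blast
  qed
  then obtain f q where fq: "\<And>\<alpha>. \<alpha> < \<delta> \<Longrightarrow> Well_order (q \<alpha>) \<and> \<alpha> = abs_ordinal (q \<alpha>)
      \<and> q \<alpha> =o Restr r (underS r (f \<alpha>))"
    by metis
  have "inj_on f {..<\<delta>}"
  proof (rule inj_onI)
    fix \<alpha> \<beta> assume a: "\<alpha> \<in> {..<\<delta>}" "\<beta> \<in> {..<\<delta>}" "f \<alpha> = f \<beta>"
    then have "q \<alpha> =o q \<beta>"
      using fq ordIso_symmetric ordIso_transitive by (metis lessThan_iff)
    then have "abs_ordinal (q \<alpha>) = abs_ordinal (q \<beta>)"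
      using Quotient3_rel[OF Quotient3_ordinal] fq a(1,2) ordIso_self_iff by (metis lessThan_iff)
    then show "\<alpha> = \<beta>"
      using fq a by (metis lessThan_iff)
  qed
  then show ?thesis
    by (intro card_of_ordLeqI[of f]) auto
qed

lemma bounded_image_segment: "\<exists>\<beta>::ordinal. \<forall>\<alpha>\<in>f ` {..<\<delta>::ordinal}. \<alpha> < \<beta>"
  by (rule ordinal_bounded) (rule ordLeq_transitive[OF card_of_image card_initial_segment])

lemma bounded_countable:
  assumes "countable (A :: ordinal set)"
  shows "\<exists>\<beta>. \<forall>\<alpha>\<in>A. \<alpha> < \<beta>"
proof (rule ordinal_bounded)
  from assms obtain f :: "ordinal \<Rightarrow> nat" where f: "inj_on f A"
    by (auto simp: countable_def)
  then have "inj_on (\<lambda>x. real (f x)) A"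
    by (auto simp: inj_on_def)
  then show "|A| \<le>o |UNIV :: real set|"
    by (intro card_of_ordLeqI[of "\<lambda>x. real (f x)"]) auto
qed

text \<open>
  If all initial segments were countable, the ordinals would form a set that neither embeds into
  the reals (being unbounded) nor contains a copy of them (which would be bounded, hence countable).
\<close>

lemma ex_uncountable_segment: "\<exists>\<alpha>::ordinal. uncountable {..<\<alpha>}"
proof (rule ccontr)
  assume *: "\<nexists>\<alpha>::ordinal. uncountable {..<\<alpha>}"
  consider "|UNIV :: ordinal set| \<le>o |UNIV :: real set|" | "|UNIV :: real set| \<le>o |UNIV :: ordinal set|"
    using ordLeq_total[OF card_of_Well_order card_of_Well_order] by blast
  then show False
  proof cases
    case 1
    from ordinal_bounded[OF this] show False by (auto simp: less_le)
  next
    case 2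
    then obtain f :: "real \<Rightarrow> ordinal" where f: "inj f"
      using card_of_ordLeq[of "UNIV :: real set" "UNIV :: ordinal set"] by auto
    obtain \<beta> where "\<forall>\<alpha>\<in>range f. \<alpha> < \<beta>"
      using ordinal_bounded[OF card_of_image[of f UNIV]] by blast
    then have "range f \<subseteq> {..<\<beta>}" by auto
    then have "countable (range f)"
      using * countable_subset by blast
    then have "countable (UNIV :: real set)"
      using countable_image_inj_on[OF _ f] by blast
    then show False
      using uncountable_UNIV_real by blast
  qed
qed

unbundle no cardinal_syntax

text \<open>
  The existence of some uncountable segment matters here: it makes the least one in the definition of
  \<open>omega1\<close> a genuine minimum.
\<close>

lemma less_omega1_iff: "\<alpha> < omega1 \<longleftrightarrow> countable {..<\<alpha>}"
proof
  show "countable {..<\<alpha>}" if "\<alpha> < omega1"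
    using not_less_Least that unfolding omega1_def by blast
  show "\<alpha> < omega1" if c: "countable {..<\<alpha>}"
  proof (rule ccontr)
    assume "\<not> \<alpha> < omega1"
    then have "{..<omega1} \<subseteq> {..<\<alpha>}" by auto
    with c have "countable {..<omega1}" by (rule countable_subset[rotated])
    then show False
      unfolding omega1_def using LeastI_ex[OF ex_uncountable_segment] by blast
  qed
qed

lemma less_osuc_iff: "\<alpha> < osuc \<beta> \<longleftrightarrow> \<alpha> \<le> \<beta>"
  by (metis linorder_not_less osuc_le_iff)

lemma limit_osuc_less: "limit_ord \<delta> \<Longrightarrow> \<beta> < \<delta> \<Longrightarrow> osuc \<beta> < \<delta>"
  unfolding limit_ord_def by (metis osuc_le_iff order_le_less rangeI)

lemma limit_pos: "limit_ord \<delta> \<Longrightarrow> 0 < \<delta>"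
  unfolding limit_ord_def using zero_le_ordinal order_le_less by metis

lemma ordinal_induct [case_names zero osuc limit]:
  assumes "P 0" and "\<And>\<alpha>. P \<alpha> \<Longrightarrow> P (osuc \<alpha>)"
    and "\<And>\<delta>. limit_ord \<delta> \<Longrightarrow> (\<And>\<beta>. \<beta> < \<delta> \<Longrightarrow> P \<beta>) \<Longrightarrow> P \<delta>"
  shows "P \<alpha>"
proof (induction \<alpha> rule: less_induct)
  case (less \<alpha>)
  then show ?case
    using assms less_osuc unfolding limit_ord_def by (metis rangeE)
qed

lemma osup_least: "(\<And>\<alpha>. \<alpha> \<in> A \<Longrightarrow> \<alpha> \<le> \<beta>) \<Longrightarrow> osup A \<le> \<beta>"
  unfolding osup_def by (rule Least_le) auto

lemma osup_upper:
  assumes "\<exists>\<beta>. \<forall>\<alpha>\<in>A. \<alpha> < \<beta>" and "\<alpha> \<in> A"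
  shows "\<alpha> \<le> osup A"
proof -
  have "\<exists>\<beta>. \<forall>\<alpha>\<in>A. \<alpha> \<le> \<beta>"
    using assms(1) less_imp_le by blast
  from LeastI_ex[OF this] show ?thesis
    using assms(2) unfolding osup_def by blast
qed

lemma less_osupD: "\<beta> < osup A \<Longrightarrow> \<exists>\<alpha>\<in>A. \<beta> < \<alpha>"
  using osup_least[of A \<beta>] by (meson leD linorder_not_le)

lemma osup_segment_upper:
  fixes f :: "ordinal \<Rightarrow> ordinal"
  shows "\<beta> < \<delta> \<Longrightarrow> f \<beta> \<le> osup (f ` {..<\<delta>})"
  using osup_upper[OF bounded_image_segment, of "f \<beta>" f \<delta>] by simp

lemma osup_image_cong:
  fixes f g :: "ordinal \<Rightarrow> ordinal"
  shows "(\<And>\<beta>. \<beta> < \<delta> \<Longrightarrow> f \<beta> = g \<beta>) \<Longrightarrow> osup (f ` {..<\<delta>}) = osup (g ` {..<\<delta>})"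
  by (rule arg_cong[of _ _ osup], rule image_cong) auto

lemma add_zero: "\<alpha> + 0 = (\<alpha>::ordinal)"
  by (simp add: plus_ordinal_def ord_rec_0)

lemma add_osuc: "\<alpha> + osuc \<beta> = osuc (\<alpha> + \<beta>)"
  by (simp add: plus_ordinal_def ord_rec_osuc)

lemma add_limit: "limit_ord \<delta> \<Longrightarrow> \<alpha> + \<delta> = osup ((+) \<alpha> ` {..<\<delta>})"
  unfolding plus_ordinal_def
  by (rule ord_rec_limit, assumption, rule osup_image_cong)

lemma mult_zero: "\<alpha> * 0 = (0::ordinal)"
  by (simp add: times_ordinal_def ord_rec_0)

lemma mult_osuc: "\<alpha> * osuc \<beta> = \<alpha> * \<beta> + \<alpha>"
  by (simp add: times_ordinal_def ord_rec_osuc)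

lemma mult_limit: "limit_ord \<delta> \<Longrightarrow> \<alpha> * \<delta> = osup ((*) \<alpha> ` {..<\<delta>})"
  unfolding times_ordinal_def
  by (rule ord_rec_limit, assumption, rule osup_image_cong)

lemma omega_pow_zero: "omega_pow 0 = 1"
  by (simp add: omega_pow_def ord_rec_0)

lemma omega_pow_osuc: "omega_pow (osuc \<alpha>) = omega_pow \<alpha> * omega"
  by (simp add: omega_pow_def ord_rec_osuc)

lemma omega_pow_limit: "limit_ord \<delta> \<Longrightarrow> omega_pow \<delta> = osup (omega_pow ` {..<\<delta>})"
  unfolding omega_pow_def
  by (rule ord_rec_limit, assumption, rule osup_image_cong)

lemma add_strict_mono_right: "\<beta> < \<gamma> \<Longrightarrow> \<alpha> + \<beta> < \<alpha> + (\<gamma>::ordinal)"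
proof (induction \<gamma> arbitrary: \<beta> rule: ordinal_induct)
  case zero
  then show ?case using zero_le_ordinal leD by blast
next
  case (osuc \<gamma>)
  then show ?case
    by (metis add_osuc less_osuc_iff order_le_less)
next
  case (limit \<delta>)
  then have "\<alpha> + \<beta> < \<alpha> + osuc \<beta>"
    using less_osuc limit_osuc_less by blast
  also have "\<dots> \<le> \<alpha> + \<delta>"
    unfolding add_limit[OF limit(1)]
    by (rule osup_segment_upper) (rule limit_osuc_less[OF limit(1,3)])
  finally show ?case .
qed

lemma add_mono_right: "\<beta> \<le> \<gamma> \<Longrightarrow> \<alpha> + \<beta> \<le> \<alpha> + (\<gamma>::ordinal)"
  using add_strict_mono_right order_le_less by metis

lemma le_add_right_arg: "\<beta> \<le> \<alpha> + (\<beta>::ordinal)"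
proof (induction \<beta> rule: less_induct)
  case (less \<beta>)
  show ?case
  proof (rule ccontr)
    assume "\<not> \<beta> \<le> \<alpha> + \<beta>"
    then have "\<alpha> + \<beta> < \<beta>" by simp
    then show False
      using less[of "\<alpha> + \<beta>"] add_strict_mono_right[of "\<alpha> + \<beta>" \<beta> \<alpha>] by simp
  qed
qed

lemma limit_add: assumes "limit_ord \<delta>" shows "limit_ord (\<alpha> + \<delta>)"
proof -
  have "\<alpha> + \<delta> \<noteq> 0"
    using le_add_right_arg[of \<delta> \<alpha>] limit_pos[OF assms] by auto
  moreover have "\<alpha> + \<delta> \<noteq> osuc \<beta>" for \<beta>
  proof
    assume eq: "\<alpha> + \<delta> = osuc \<beta>"
    then have "\<beta> < osup ((+) \<alpha> ` {..<\<delta>})"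
      using less_osuc add_limit[OF assms] by metis
    then obtain \<gamma> where "\<gamma> < \<delta>" "\<beta> < \<alpha> + \<gamma>"
      using less_osupD by blast
    then have "osuc \<beta> < \<alpha> + \<delta>"
      using add_strict_mono_right osuc_le_iff by (metis order_le_less_trans)
    then show False using eq by simp
  qed
  ultimately show ?thesis by (auto simp: limit_ord_def)
qed

lemma less_add_limitD: "limit_ord \<delta> \<Longrightarrow> \<beta> < \<alpha> + \<delta> \<Longrightarrow> \<exists>\<gamma><\<delta>. \<beta> < \<alpha> + \<gamma>"
  using less_osupD by (fastforce simp: add_limit)

abbreviation ord_of_nat :: "nat \<Rightarrow> ordinal"
  where "ord_of_nat n \<equiv> (osuc ^^ n) 0"

lemma limit_omega: "limit_ord omega"
proof -
  define s where "s = osup (range ord_of_nat)"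
  have up: "ord_of_nat n \<le> s" for n
    unfolding s_def by (rule osup_upper[OF bounded_countable]) auto
  have "s \<noteq> 0"
    using up[of 1] osuc_le_iff[of 0 s] by auto
  moreover have "s \<noteq> osuc b" for b
  proof
    assume eq: "s = osuc b"
    then have "b < s" by (simp add: less_osuc)
    then obtain n where "b < ord_of_nat n"
      unfolding s_def using less_osupD by blast
    then have "osuc b < ord_of_nat (Suc n)"
      using osuc_le_iff[of b] less_osuc_iff by simp
    with up[of "Suc n"] eq show False by simp
  qed
  ultimately have "limit_ord s" by (auto simp: limit_ord_def)
  then show ?thesis unfolding omega_def by (rule LeastI)
qed

lemma less_omega_iff: "\<beta> < omega \<longleftrightarrow> (\<exists>n. \<beta> = ord_of_nat n)"
proof
  show "\<exists>n. \<beta> = ord_of_nat n" if "\<beta> < omega"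
    using that
  proof (induction \<beta> rule: ordinal_induct)
    case zero
    show ?case by (rule exI[of _ 0]) simp
  next
    case (osuc \<alpha>)
    then obtain n where "\<alpha> = ord_of_nat n"
      using less_osuc less_trans by blast
    then show ?case by (intro exI[of _ "Suc n"]) simp
  next
    case (limit \<delta>)
    then show ?case using not_less_Least unfolding omega_def by blast
  qed
  have "ord_of_nat n < omega" for n
    by (induction n) (auto intro: limit_pos limit_osuc_less limit_omega)
  then show "\<beta> < omega" if "\<exists>n. \<beta> = ord_of_nat n" using that by blast
qed

lemma omega_pow_osuc_upper: "omega_pow \<alpha> * ord_of_nat n \<le> omega_pow (osuc \<alpha>)"
  unfolding omega_pow_osuc mult_limit[OF limit_omega]
  by (rule osup_segment_upper) (auto simp: less_omega_iff)

lemma less_omega_pow_osucD: "\<beta> < omega_pow (osuc \<alpha>) \<Longrightarrow> \<exists>n. \<beta> < omega_pow \<alpha> * ord_of_nat n"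
  using less_osupD[of \<beta> "(*) (omega_pow \<alpha>) ` {..<omega}"]
  by (auto simp: omega_pow_osuc mult_limit[OF limit_omega] less_omega_iff)

lemma omega_pow_mono: "\<alpha> \<le> \<beta> \<Longrightarrow> omega_pow \<alpha> \<le> omega_pow \<beta>"
proof (induction \<beta> rule: ordinal_induct)
  case zero
  then show ?case using zero_le_ordinal antisym by blast
next
  case (osuc \<beta>)
  have "omega_pow \<beta> \<le> omega_pow \<beta> * ord_of_nat 1"
    by (simp add: mult_osuc le_add_right_arg)
  also have "\<dots> \<le> omega_pow (osuc \<beta>)"
    by (rule omega_pow_osuc_upper)
  finally show ?case
    using osuc less_osuc_iff by (metis order_le_less order_trans)
next
  case (limit \<delta>)
  then show ?case
    by (metis omega_pow_limit order_le_less osup_segment_upper)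
qed

subsection \<open>Countable ordinals\<close>

lemma countable_zero: "0 < omega1"
  unfolding less_omega1_iff by (rule countable_subset[of _ "{}"]) (use zero_le_ordinal leD in auto)

lemma countable_osuc: "\<alpha> < omega1 \<Longrightarrow> osuc \<alpha> < omega1"
proof -
  assume "\<alpha> < omega1"
  then have "countable (insert \<alpha> {..<\<alpha>})"
    by (simp add: less_omega1_iff)
  moreover have "{..<osuc \<alpha>} = insert \<alpha> {..<\<alpha>}"
    by (auto simp: less_osuc_iff)
  ultimately show ?thesis by (simp add: less_omega1_iff)
qed

lemma osuc_less_omega1D: "osuc \<alpha> < omega1 \<Longrightarrow> \<alpha> < omega1"
  using less_osuc less_trans by blast

lemma countable_osup:
  assumes "\<delta> < omega1" and "\<And>\<beta>. \<beta> < \<delta> \<Longrightarrow> f \<beta> < omega1"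
  shows "osup (f ` {..<\<delta>}) < omega1"
proof -
  have "countable (\<Union>\<beta>\<in>{..<\<delta>}. {..<f \<beta>})"
    by (rule countable_UN) (use assms less_omega1_iff in auto)
  moreover have "{..<osup (f ` {..<\<delta>})} \<subseteq> (\<Union>\<beta>\<in>{..<\<delta>}. {..<f \<beta>})"
    using less_osupD by fastforce
  ultimately show ?thesis
    unfolding less_omega1_iff by (rule countable_subset[rotated])
qed

lemma countable_add: "\<alpha> < omega1 \<Longrightarrow> \<beta> < omega1 \<Longrightarrow> \<alpha> + \<beta> < omega1"
proof (induction \<beta> rule: ordinal_induct)
  case (osuc \<beta>)
  with osuc_less_omega1D[OF osuc.prems(2)] show ?case by (simp add: add_osuc countable_osuc)
next
  case (limit \<delta>)
  then have "\<beta> < omega1" if "\<beta> < \<delta>" for \<beta>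
    using that less_trans by blast
  with limit show ?case by (simp add: add_limit countable_osup)
qed (simp add: add_zero)

lemma countable_mult: "\<alpha> < omega1 \<Longrightarrow> \<beta> < omega1 \<Longrightarrow> \<alpha> * \<beta> < omega1"
proof (induction \<beta> rule: ordinal_induct)
  case zero
  show ?case by (simp add: mult_zero countable_zero)
next
  case (osuc \<beta>)
  with osuc_less_omega1D[OF osuc.prems(2)] show ?case by (simp add: mult_osuc countable_add)
next
  case (limit \<delta>)
  then have "\<beta> < omega1" if "\<beta> < \<delta>" for \<beta>
    using that less_trans by blast
  with limit show ?case by (simp add: mult_limit countable_osup)
qed

lemma countable_omega: "omega < omega1"
proof -
  have "{..<omega} = range ord_of_nat"
    by (auto simp: less_omega_iff)
  then show ?thesis unfolding less_omega1_iff by simp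
qed

lemma countable_omega_pow: "\<alpha> < omega1 \<Longrightarrow> omega_pow \<alpha> < omega1"
proof (induction \<alpha> rule: ordinal_induct)
  case zero
  show ?case by (simp add: omega_pow_zero one_ordinal_def countable_osuc countable_zero)
next
  case (osuc \<beta>)
  with osuc_less_omega1D[OF osuc.prems] show ?case
    by (simp add: omega_pow_osuc countable_mult countable_omega)
next
  case (limit \<delta>)
  then have "\<beta> < omega1" if "\<beta> < \<delta>" for \<beta>
    using that less_trans by blast
  with limit show ?case by (simp add: omega_pow_limit countable_osup)
qed

section \<open>Regular families and their brackets\<close>

definition hereditary :: "nat set set \<Rightarrow> bool"
  where "hereditary A \<longleftrightarrow> (\<forall>F\<in>A. \<forall>G\<subseteq>F. G \<in> A)"

definition spreading :: "nat set set \<Rightarrow> bool"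
  where "spreading A \<longleftrightarrow> (\<forall>F\<in>A. \<forall>f. strict_mono_on F f \<longrightarrow> (\<forall>x\<in>F. x \<le> f x) \<longrightarrow> f ` F \<in> A)"

text \<open>The usual notion without compactness, with all singletons included.\<close>

definition regular_family :: "nat set set \<Rightarrow> bool"
  where "regular_family A \<longleftrightarrow> A \<subseteq> fin_pos \<and> (\<forall>n\<ge>1. {n} \<in> A) \<and> hereditary A \<and> spreading A"

lemma spreading_dominate:
  fixes f h :: "nat \<Rightarrow> nat"
  assumes "spreading A" "f ` F \<in> A" "strict_mono_on F f" "strict_mono_on F h"
    and "\<And>x. x \<in> F \<Longrightarrow> f x \<le> h x"
  shows "h ` F \<in> A"
proof -
  have inj: "inj_on f F" by (rule strict_mono_on_imp_inj_on[OF assms(3)])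
  \<comment> \<open>The map with \<open>g \<circ> f = h\<close> on \<open>F\<close> moves points to the right.\<close>
  define g where "g = h \<circ> inv_into F f"
  have gf: "g (f x) = h x" if "x \<in> F" for x
    using inv_into_f_f[OF inj that] by (simp add: g_def)
  have "strict_mono_on (f ` F) g"
  proof (rule strict_mono_onI)
    fix r s assume "r \<in> f ` F" "s \<in> f ` F" "r < s"
    then obtain x y where xy: "x \<in> F" "y \<in> F" "r = f x" "s = f y" by blast
    with \<open>r < s\<close> have "x < y"
      using strict_mono_on_less[OF assms(3)] by blast
    with xy show "g r < g s"
      using gf strict_mono_onD[OF assms(4)] by metis
  qed
  moreover have "\<forall>y\<in>f ` F. y \<le> g y"
    using assms(5) gf by auto
  ultimately have "g ` f ` F \<in> A"
    using assms(1,2) unfolding spreading_def by blast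
  then show ?thesis
    using gf by (simp add: image_image cong: image_cong)
qed

lemma regular_finite: "regular_family A \<Longrightarrow> F \<in> A \<Longrightarrow> finite F"
  and regular_fin_pos: "regular_family A \<Longrightarrow> F \<in> A \<Longrightarrow> F \<in> fin_pos"
  and regular_singleton: "regular_family A \<Longrightarrow> 1 \<le> n \<Longrightarrow> {n} \<in> A"
  and regular_subset: "regular_family A \<Longrightarrow> F \<in> A \<Longrightarrow> G \<subseteq> F \<Longrightarrow> G \<in> A"
  and regular_spreading: "regular_family A \<Longrightarrow> spreading A"
  by (auto simp: regular_family_def fin_pos_def hereditary_def)

lemma regular_empty: "regular_family A \<Longrightarrow> {} \<in> A"
  using regular_subset[OF _ regular_singleton[of A 1], of "{}"] by simp

abbreviation set_less :: "nat set \<Rightarrow> nat set \<Rightarrow> bool"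
  where "set_less E F \<equiv> (\<forall>a\<in>E. \<forall>b\<in>F. a < b)"

text \<open>The successiveness of neighbours extends to all pairs because the members are non-empty.\<close>

lemma admissible_iff:
  "admissible A Es \<longleftrightarrow> (\<forall>E\<in>set Es. E \<in> fin_pos \<and> E \<noteq> {}) \<and> sorted_wrt set_less Es \<and> Min ` set Es \<in> A"
proof -
  have "(\<forall>i. Suc i < length Es \<longrightarrow> Max (Es ! i) < Min (Es ! Suc i)) \<longleftrightarrow> sorted_wrt set_less Es"
    if ne: "\<forall>E\<in>set Es. E \<in> fin_pos \<and> E \<noteq> {}"
  proof
    have fin: "finite (Es ! i)" "Es ! i \<noteq> {}" if "i < length Es" for i
      using ne that nth_mem[of i Es] by (auto simp: fin_pos_def)
    show "sorted_wrt set_less Es" if *: "\<forall>i. Suc i < length Es \<longrightarrow> Max (Es ! i) < Min (Es ! Suc i)"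
    proof -
      have "Max (Es ! i) < Min (Es ! (i + Suc d))" if "i + Suc d < length Es" for i d
        using that
      proof (induction d)
        case (Suc d)
        then have "Max (Es ! i) < Min (Es ! (i + Suc d))" by simp
        also have "\<dots> \<le> Max (Es ! (i + Suc d))"
          using fin[of "i + Suc d"] Suc.prems by simp
        also have "\<dots> < Min (Es ! (i + Suc (Suc d)))"
          using * Suc.prems by simp
        finally show ?case .
      qed (use * in simp)
      then have "Max (Es ! i) < Min (Es ! j)" if "i < j" "j < length Es" for i j
        using that less_iff_Suc_add[of i j] by auto
      then show ?thesis
        unfolding sorted_wrt_iff_nth_less
        using fin by (meson Max_ge Min_le less_trans order_le_less_trans order_less_le_trans)
    qed
    show "\<forall>i. Suc i < length Es \<longrightarrow> Max (Es ! i) < Min (Es ! Suc i)" if "sorted_wrt set_less Es"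
      using that fin unfolding sorted_wrt_iff_nth_less by (meson Max_in Min_in Suc_lessD lessI)
  qed
  then show ?thesis unfolding admissible_def by blast
qed

lemma admissible_finite: "admissible A Es \<Longrightarrow> E \<in> set Es \<Longrightarrow> finite E \<and> 0 \<notin> E \<and> E \<noteq> {}"
  by (auto simp: admissible_def fin_pos_def)

lemma admissible_comparable:
  assumes "admissible A Es" "E \<in> set Es" "E' \<in> set Es" "E \<noteq> E'"
  shows "set_less E E' \<or> set_less E' E"
proof -
  from assms(2,3) obtain i j where ij: "i < length Es" "j < length Es" "E = Es ! i" "E' = Es ! j"
    by (auto simp: in_set_conv_nth)
  have srt: "sorted_wrt set_less Es" using assms(1) by (simp add: admissible_iff)
  have "set_less (Es ! k) (Es ! l)" if "k < l" "l < length Es" for k l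
    by (rule sorted_wrt_nth_less[OF srt that])
  moreover have "i < j \<or> j < i" using ij assms(4) by auto
  ultimately show ?thesis using ij by metis
qed

lemma admissible_inj_Min:
  assumes "admissible A Es"
  shows "inj_on Min (set Es)"
proof (rule inj_onI)
  fix E E' assume E: "E \<in> set Es" "E' \<in> set Es" "Min E = Min E'"
  then have "Min E \<in> E" "Min E \<in> E'"
    using admissible_finite[OF assms] Min_in by metis+
  then show "E = E'"
    using admissible_comparable[OF assms E(1,2)] by blast
qed

lemma admissible_distinct:
  assumes "admissible A Es" shows "distinct Es"
  unfolding distinct_conv_nth
proof (intro allI impI)
  have srt: "sorted_wrt set_less Es" using assms by (simp add: admissible_iff)
  have ne: "Es ! i \<noteq> Es ! j" if "i < j" "j < length Es" for i j
    using sorted_wrt_nth_less[OF srt that] admissible_finite[OF assms, of "Es ! j"] that by auto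
  fix i j assume "i < length Es" "j < length Es" "i \<noteq> j"
  then show "Es ! i \<noteq> Es ! j" using ne[of i j] ne[of j i] by (metis linorder_neqE_nat)
qed

lemma admissible_sum_list: "admissible A Es \<Longrightarrow> (\<Sum>E\<leftarrow>Es. f E) = (\<Sum>E\<in>set Es. f E)"
  by (simp add: sum_list_distinct_conv_sum_set admissible_distinct)

lemma admissible_sum_Union:
  assumes "admissible A Es" shows "sum f (\<Union>(set Es)) = (\<Sum>E\<in>set Es. sum f E)"
  using sum.UNION_disjoint[of "set Es" "\<lambda>E. E" f] admissible_finite[OF assms]
    admissible_comparable[OF assms] by fastforce

lemma Min_image_strict_mono_on:
  fixes f :: "nat \<Rightarrow> nat"
  assumes "finite E" "E \<noteq> {}" "strict_mono_on E f"
  shows "Min (f ` E) = f (Min E)"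
proof (rule Min_eqI)
  show "f (Min E) \<le> y" if "y \<in> f ` E" for y
    using that assms(1,2) by (auto intro!: strict_mono_on_leD[OF assms(3)] Min_in)
qed (use assms in \<open>auto intro!: imageI Min_in\<close>)

lemma bracket_empty: "{} \<in> bracket A G"
  by (simp add: bracket_def)

lemma bracketI: "admissible A Es \<Longrightarrow> set Es \<subseteq> G \<Longrightarrow> \<Union>(set Es) \<in> bracket A G"
  by (auto simp: bracket_def)

lemma bracketE:
  assumes "F \<in> bracket A G" "F \<noteq> {}"
  obtains Es where "F = \<Union>(set Es)" "admissible A Es" "set Es \<subseteq> G"
  using assms by (auto simp: bracket_def)

text \<open>A strictly increasing map commutes with the minima of the pieces of a decomposition.\<close>

lemma bracket_image:
  assumes "admissible A Es" and mono: "strict_mono_on (\<Union>(set Es)) f"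
    and ge: "\<And>x. x \<in> \<Union>(set Es) \<Longrightarrow> x \<le> f x"
    and G: "\<And>E. E \<in> set Es \<Longrightarrow> f ` E \<in> G" and A: "f ` Min ` set Es \<in> A'"
  shows "f ` \<Union>(set Es) \<in> bracket A' G"
proof -
  have m: "strict_mono_on E f" if "E \<in> set Es" for E
    by (rule monotone_on_subset[OF mono]) (use that in blast)
  have Min: "Min (f ` E) = f (Min E)" if "E \<in> set Es" for E
    using Min_image_strict_mono_on[OF _ _ m[OF that]] admissible_finite[OF assms(1) that] by simp
  have "0 \<notin> f ` E" if "E \<in> set Es" for E
  proof
    assume "0 \<in> f ` E"
    then obtain x where x: "x \<in> E" "f x = 0" by auto
    with ge[of x] that have "x = 0" by auto
    with x show False using admissible_finite[OF assms(1) that] by simp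
  qed
  then have "\<forall>E\<in>set (map ((`) f) Es). E \<in> fin_pos \<and> E \<noteq> {}"
    using admissible_finite[OF assms(1)] by (auto simp: fin_pos_def)
  moreover have "sorted_wrt set_less (map ((`) f) Es)"
    unfolding sorted_wrt_map
  proof (rule sorted_wrt_mono_rel)
    show "sorted_wrt set_less Es" using assms(1) by (simp add: admissible_iff)
    show "set_less (f ` x) (f ` y)" if "x \<in> set Es" "y \<in> set Es" "set_less x y" for x y
      using that strict_mono_onD[OF mono] by blast
  qed
  moreover have "Min ` set (map ((`) f) Es) \<in> A'"
    using A Min by (simp add: image_image cong: image_cong)
  ultimately have "admissible A' (map ((`) f) Es)"
    unfolding admissible_iff by blast
  from bracketI[OF this, of G] G show ?thesis
    by (auto simp: image_Union image_subset_iff)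
qed

lemma spreading_bracket:
  assumes "regular_family A" "regular_family G"
  shows "spreading (bracket A G)"
  unfolding spreading_def
proof (intro ballI allI impI)
  fix F f assume F: "F \<in> bracket A G" and f: "strict_mono_on F f" "\<forall>x\<in>F. x \<le> f x"
  show "f ` F \<in> bracket A G"
  proof (cases "F = {}")
    case False
    then obtain Es where Es: "F = \<Union>(set Es)" "admissible A Es" "set Es \<subseteq> G"
      using F by (auto elim: bracketE)
    have sub: "Min ` set Es \<subseteq> F"
      using admissible_finite[OF Es(2)] Es(1) by auto
    have "f ` Min ` set Es \<in> A"
      using regular_spreading[OF assms(1)] Es(2) f sub monotone_on_subset[OF f(1) sub]
      unfolding spreading_def admissible_def by blast
    moreover have "f ` E \<in> G" if "E \<in> set Es" for E
    proof -
      have "E \<subseteq> F" using that Es(1) by blast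
      then show ?thesis
        using regular_spreading[OF assms(2)] Es(3) that f monotone_on_subset[OF f(1)]
        unfolding spreading_def by blast
    qed
    ultimately show ?thesis
      using bracket_image[OF Es(2), of f G A] f Es(1) by blast
  qed (simp add: bracket_empty)
qed

text \<open>
  Passing to a subset drops some pieces and moves the minima of the others to the right, so the
  new set of minima is a spread of a subset of the old one.
\<close>

lemma hereditary_bracket:
  assumes "regular_family A" "regular_family G"
  shows "hereditary (bracket A G)"
  unfolding hereditary_def
proof (intro ballI allI impI)
  fix F H assume F: "F \<in> bracket A G" and H: "H \<subseteq> F"
  show "H \<in> bracket A G"
  proof (cases "F = {}")
    case True
    with H show ?thesis by (simp add: bracket_empty)
  next
    case False
    then obtain Es where Es: "F = \<Union>(set Es)" "admissible A Es" "set Es \<subseteq> G"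
      using F by (auto elim: bracketE)
    define Es' where "Es' = filter (\<lambda>E. E \<inter> H \<noteq> {}) Es"
    define Hs where "Hs = map (\<lambda>E. E \<inter> H) Es'"
    have Es'_sub: "set Es' \<subseteq> set Es" by (auto simp: Es'_def)
    have fin: "finite E" "0 \<notin> E" "E \<inter> H \<noteq> {}" if "E \<in> set Es'" for E
      using admissible_finite[OF Es(2), of E] that by (auto simp: Es'_def)
    have srt: "sorted_wrt set_less Es"
      using Es(2) by (simp add: admissible_iff)
    then have srt': "sorted_wrt set_less Es'"
      unfolding Es'_def by (rule sorted_wrt_filter)
    then have "sorted_wrt set_less Hs"
      unfolding Hs_def sorted_wrt_map by (rule sorted_wrt_mono_rel[rotated]) auto
    moreover have "\<forall>E\<in>set Hs. E \<in> fin_pos \<and> E \<noteq> {}"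
      using fin by (auto simp: Hs_def fin_pos_def)
    moreover have "Min ` set Hs \<in> A"
    proof -
      have MinA: "Min ` set Es' \<in> A"
        using regular_subset[OF assms(1)] Es(2) Es'_sub by (metis admissible_def image_mono)
      have less: "Min E < Min E' \<and> Min (E \<inter> H) < Min (E' \<inter> H)"
        if "E \<in> set Es'" "E' \<in> set Es'" "set_less E E'" for E E'
      proof -
        have "Min E \<in> E" "Min E' \<in> E'" "Min (E \<inter> H) \<in> E" "Min (E' \<inter> H) \<in> E'"
          using fin[OF that(1)] fin[OF that(2)]
            Min_in[of "E \<inter> H"] Min_in[of "E' \<inter> H"] Min_in[of E] Min_in[of E'] by blast+
        then show ?thesis using that(3) by blast
      qed
      have comparable: "E = E' \<or> set_less E E' \<or> set_less E' E"
        if "E \<in> set Es'" "E' \<in> set Es'" for E E'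
        using that Es'_sub admissible_comparable[OF Es(2)] by blast
      have inj: "inj_on Min (set Es')"
        by (rule inj_onI) (metis comparable less less_irrefl)
      \<comment> \<open>\<open>g\<close> sends the minimum of a piece to the minimum of its trace on \<open>H\<close>.\<close>
      define g where "g m = Min (inv_into (set Es') Min m \<inter> H)" for m
      have g: "g (Min E) = Min (E \<inter> H)" if "E \<in> set Es'" for E
        using inv_into_f_f[OF inj that] by (simp add: g_def)
      have "strict_mono_on (Min ` set Es') g"
      proof (rule strict_mono_onI)
        fix r s assume rs: "r \<in> Min ` set Es'" "s \<in> Min ` set Es'" "r < s"
        then obtain E E' where E: "E \<in> set Es'" "E' \<in> set Es'" "r = Min E" "s = Min E'"
          by blast
        with rs(3) have "set_less E E'"
          using comparable less by (metis less_asym less_irrefl)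
        with E show "g r < g s"
          using g less by metis
      qed
      moreover have "\<forall>m\<in>Min ` set Es'. m \<le> g m"
        using g fin by (auto intro!: Min.subset_imp)
      ultimately have "g ` Min ` set Es' \<in> A"
        using MinA regular_spreading[OF assms(1)] unfolding spreading_def by blast
      then show ?thesis
        using g by (simp add: Hs_def image_image cong: image_cong)
    qed
    ultimately have "admissible A Hs"
      unfolding admissible_iff by blast
    moreover have "set Hs \<subseteq> G"
      using Es(3) Es'_sub regular_subset[OF assms(2)] by (auto simp: Hs_def)
    moreover have "\<Union>(set Hs) = H"
      using H Es(1) by (auto simp: Hs_def Es'_def)
    ultimately show ?thesis
      using bracketI by metis
  qed
qed

lemma subset_bracket:
  assumes "regular_family A" "regular_family G"
  shows "G \<subseteq> bracket A G"
proof
  fix F assume F: "F \<in> G"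
  show "F \<in> bracket A G"
  proof (cases "F = {}")
    case False
    with F regular_fin_pos[OF assms(2)] have "F \<in> fin_pos" "1 \<le> Min F"
      by (auto simp: fin_pos_def Suc_le_eq intro: gr0I)
    then have "admissible A [F]"
      using False regular_singleton[OF assms(1)] by (simp add: admissible_iff)
    from bracketI[OF this, of G] F show ?thesis by simp
  qed (simp add: bracket_empty)
qed

lemma regular_bracket:
  assumes "regular_family A" "regular_family G"
  shows "regular_family (bracket A G)"
proof -
  have "bracket A G \<subseteq> fin_pos"
    by (auto simp: bracket_def admissible_def fin_pos_def)
  moreover have "\<forall>n\<ge>1. {n} \<in> bracket A G"
    using subset_bracket[OF assms] regular_singleton[OF assms(2)] by blast
  ultimately show ?thesis
    using hereditary_bracket[OF assms] spreading_bracket[OF assms] by (simp add: regular_family_def)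
qed

lemma regular_schreier0: "regular_family schreier0"
proof -
  have "hereditary schreier0"
    unfolding hereditary_def schreier0_def fin_pos_def
    by (auto intro: finite_subset) (meson card_mono le_trans)
  moreover have "f ` F \<in> schreier0" if "F \<in> schreier0" "\<forall>x\<in>F. x \<le> f x" for F f
    using that card_image_le[of F f] by (auto simp: schreier0_def fin_pos_def)
  ultimately show ?thesis
    by (auto simp: regular_family_def spreading_def) (auto simp: schreier0_def fin_pos_def)
qed

lemma regular_schreier1: "regular_family schreier1"
proof -
  have "hereditary schreier1"
    unfolding hereditary_def
  proof (intro ballI allI impI)
    fix F G assume *: "F \<in> schreier1" "G \<subseteq> F"
    show "G \<in> schreier1"
    proof (cases "G = {}")
      case False
      with * have F: "finite F" "0 \<notin> F" "card F \<le> Min F"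
        by (auto simp: schreier1_def fin_pos_def)
      then have "card G \<le> Min G"
        using card_mono[OF F(1) *(2)] Min.subset_imp[OF *(2) False F(1)] by simp
      then show ?thesis
        using F * False finite_subset by (auto simp: schreier1_def fin_pos_def)
    qed (simp add: schreier1_def)
  qed
  moreover have "f ` F \<in> schreier1"
    if *: "F \<in> schreier1" "strict_mono_on F f" "\<forall>x\<in>F. x \<le> f x" for F f
  proof (cases "F = {}")
    case False
    with * have F: "finite F" "0 \<notin> F" "card F \<le> Min F"
      by (auto simp: schreier1_def fin_pos_def)
    then have "card (f ` F) \<le> Min (f ` F)"
      using card_image_le[OF F(1), of f] Min_image_strict_mono_on[OF F(1) False *(2)] *(3) False
      by (metis Min_in order_trans)
    then show ?thesis
      using F * False by (auto simp: schreier1_def fin_pos_def)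
  qed (simp add: schreier1_def)
  ultimately show ?thesis
    by (auto simp: regular_family_def spreading_def) (auto simp: schreier1_def fin_pos_def)
qed

subsection \<open>Embeddings of families\<close>

text \<open>
  Index comparisons between Schreier families hold only up to passing to a subsequence of the positive
  integers; this relation records that, and it composes.
\<close>

definition embeds :: "nat set set \<Rightarrow> nat set set \<Rightarrow> bool"
  where "embeds A B \<longleftrightarrow> (\<exists>\<phi>::nat \<Rightarrow> nat. strict_mono \<phi> \<and> (\<forall>F\<in>A. \<phi> ` F \<in> B))"

lemma embeds_subset: "A \<subseteq> B \<Longrightarrow> embeds A B"
  unfolding embeds_def by (rule exI[of _ id]) (auto simp: strict_mono_def)

lemma embeds_refl: "embeds A A"
  by (simp add: embeds_subset)

lemma embeds_trans:
  assumes "embeds A B" "embeds B C" shows "embeds A C"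
proof -
  obtain \<phi> \<psi> :: "nat \<Rightarrow> nat" where "strict_mono \<phi>" "strict_mono \<psi>"
    "\<forall>F\<in>A. \<phi> ` F \<in> B" "\<forall>F\<in>B. \<psi> ` F \<in> C"
    using assms unfolding embeds_def by blast
  moreover have "(\<psi> \<circ> \<phi>) ` F = \<psi> ` \<phi> ` F" for F
    by (rule image_comp[symmetric])
  ultimately show ?thesis
    unfolding embeds_def using strict_mono_o[of \<psi> \<phi>]
    by (intro exI[of _ "\<psi> \<circ> \<phi>"] conjI ballI) simp_all
qed

lemma embeds_bracket:
  assumes "regular_family A" "regular_family G" and "embeds A A'" "embeds G G'"
    and "regular_family A'" "regular_family G'"
  shows "embeds (bracket A G) (bracket A' G')"
proof -
  have left: "embeds (bracket A G) (bracket A' G)"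
  proof -
    obtain \<phi> :: "nat \<Rightarrow> nat" where \<phi>: "strict_mono \<phi>" "\<forall>F\<in>A. \<phi> ` F \<in> A'"
      using assms(3) unfolding embeds_def by blast
    have mo: "strict_mono_on S \<phi>" for S
      using \<phi>(1) by (auto simp: strict_mono_on_def strict_mono_def)
    have "\<phi> ` F \<in> bracket A' G" if F: "F \<in> bracket A G" for F
    proof (cases "F = {}")
      case False
      then obtain Es where Es: "F = \<Union>(set Es)" "admissible A Es" "set Es \<subseteq> G"
        using F by (auto elim: bracketE)
      moreover have "\<phi> ` E \<in> G" if "E \<in> set Es" for E
        using regular_spreading[OF assms(2)] Es(3) that mo strict_mono_imp_increasing[OF \<phi>(1)]
        unfolding spreading_def by blast
      ultimately show ?thesis
        using bracket_image[OF Es(2), of \<phi> G A'] mo \<phi> strict_mono_imp_increasing[OF \<phi>(1)]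
        by (auto simp: admissible_def)
    qed (simp add: bracket_empty)
    then show ?thesis using \<phi>(1) unfolding embeds_def by blast
  qed
  have right: "embeds (bracket A' G) (bracket A' G')"
  proof -
    obtain \<phi> :: "nat \<Rightarrow> nat" where \<phi>: "strict_mono \<phi>" "\<forall>F\<in>G. \<phi> ` F \<in> G'"
      using assms(4) unfolding embeds_def by blast
    have mo: "strict_mono_on S \<phi>" for S
      using \<phi>(1) by (auto simp: strict_mono_on_def strict_mono_def)
    have "\<phi> ` F \<in> bracket A' G'" if F: "F \<in> bracket A' G" for F
    proof (cases "F = {}")
      case False
      then obtain Es where Es: "F = \<Union>(set Es)" "admissible A' Es" "set Es \<subseteq> G"
        using F by (auto elim: bracketE)
      moreover have "\<phi> ` Min ` set Es \<in> A'"
        using regular_spreading[OF assms(5)] Es(2) mo strict_mono_imp_increasing[OF \<phi>(1)]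
        unfolding spreading_def admissible_def by blast
      ultimately show ?thesis
        using bracket_image[OF Es(2), of \<phi> G' A'] mo \<phi> strict_mono_imp_increasing[OF \<phi>(1)]
        by auto
    qed (simp add: bracket_empty)
    then show ?thesis using \<phi>(1) unfolding embeds_def by blast
  qed
  show ?thesis by (rule embeds_trans[OF left right])
qed

text \<open>
  The diagonal argument behind the limit steps.  For spreading \<open>B\<close> an embedding may be replaced by
  any pointwise larger increasing map, and \<open>\<phi> i = max (\<phi>\<^sub>0 i, \<dots>, \<phi>\<^sub>i i)\<close> dominates \<open>\<phi>\<^sub>n\<close> on
  \<open>{n, n + 1, \<dots>}\<close>.
\<close>

lemma embeds_diagonal:
  assumes "regular_family B" and emb: "\<And>n. embeds (A n) B"
    and C: "\<And>F. F \<in> C \<Longrightarrow> F \<noteq> {} \<Longrightarrow> \<exists>n. F \<in> A n \<and> (\<forall>x\<in>F. n \<le> x)"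
  shows "embeds C B"
proof -
  obtain f :: "nat \<Rightarrow> nat \<Rightarrow> nat" where f: "\<And>n. strict_mono (f n)" "\<And>n F. F \<in> A n \<Longrightarrow> f n ` F \<in> B"
    using emb unfolding embeds_def by metis
  define \<phi> where "\<phi> i = Max ((\<lambda>n. f n i) ` {..i})" for i
  have ge: "f n i \<le> \<phi> i" if "n \<le> i" for n i
    using that unfolding \<phi>_def by (intro Max_ge) auto
  have "\<phi> i < \<phi> (Suc i)" for i
  proof -
    have "\<phi> i \<in> (\<lambda>n. f n i) ` {..i}"
      unfolding \<phi>_def by (intro Max_in) auto
    then obtain n where n: "n \<le> i" "\<phi> i = f n i" by auto
    note n(2)
    also have "f n i < f n (Suc i)"
      using f(1) by (simp add: strict_mono_def)
    also have "\<dots> \<le> \<phi> (Suc i)" using n by (intro ge) simp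
    finally show ?thesis .
  qed
  then have mono: "strict_mono \<phi>" by (simp add: strict_mono_Suc_iff)
  have "\<phi> ` F \<in> B" if F: "F \<in> C" for F
  proof (cases "F = {}")
    case True
    then show ?thesis using regular_empty[OF assms(1)] by simp
  next
    case False
    then obtain n where n: "F \<in> A n" "\<forall>x\<in>F. n \<le> x" using C F by blast
    show ?thesis
      by (rule spreading_dominate[OF regular_spreading[OF assms(1)] f(2)[OF n(1)]])
        (use mono f(1) ge n(2) in \<open>auto simp: strict_mono_on_def strict_mono_def\<close>)
  qed
  then show ?thesis using mono unfolding embeds_def by blast
qed

text \<open>
  The minima of the inner decompositions are themselves decomposed by the outer one, with the same
  outer minima.
\<close>

lemma bracket_assoc:
  "bracket A (bracket B G) \<subseteq> bracket (bracket A B) G"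
proof
  fix F assume F: "F \<in> bracket A (bracket B G)"
  show "F \<in> bracket (bracket A B) G"
  proof (cases "F = {}")
    case False
    then obtain Es where Es: "F = \<Union>(set Es)" "admissible A Es" "set Es \<subseteq> bracket B G"
      using F by (auto elim: bracketE)
    have "\<exists>Ls. E = \<Union>(set Ls) \<and> admissible B Ls \<and> set Ls \<subseteq> G" if "E \<in> set Es" for E
      using that Es(3) admissible_finite[OF Es(2) that] by (metis bracketE subsetD)
    then obtain L where L: "\<And>E. E \<in> set Es \<Longrightarrow> E = \<Union>(set (L E))"
      "\<And>E. E \<in> set Es \<Longrightarrow> admissible B (L E)" "\<And>E. E \<in> set Es \<Longrightarrow> set (L E) \<subseteq> G"
      by metis
    define Hs where "Hs = concat (map L Es)"
    define Ms where "Ms = map (\<lambda>E. Min ` set (L E)) Es"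
    have ne: "L E \<noteq> []" if "E \<in> set Es" for E
      using L(1)[OF that] admissible_finite[OF Es(2) that] by auto
    have Min_in_E: "Min H \<in> E" "H \<subseteq> E" "finite H" "H \<noteq> {}" "0 \<notin> H" if "E \<in> set Es" "H \<in> set (L E)" for E H
    proof -
      show *: "finite H" "H \<noteq> {}" "0 \<notin> H" "H \<subseteq> E"
        using L(1)[OF that(1)] admissible_finite[OF L(2)[OF that(1)] that(2)] that(2) by blast+
      show "Min H \<in> E"
        using Min_in[OF *(1,2)] *(4) by blast
    qed
    have srt: "sorted_wrt set_less Es" using Es(2) by (simp add: admissible_iff)
    have srtL: "sorted_wrt set_less (L E)" if "E \<in> set Es" for E
      using L(2)[OF that] by (simp add: admissible_iff)
    have concat_sorted: "sorted_wrt set_less (concat (map L Es'))"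
      if "sorted_wrt set_less Es'" "set Es' \<subseteq> set Es" for Es'
      using that
    proof (induction Es')
      case (Cons E Es')
      have "set_less x y" if "x \<in> set (L E)" "y \<in> set (concat (map L Es'))" for x y
      proof -
        obtain E' where E': "E' \<in> set Es'" "y \<in> set (L E')" using \<open>y \<in> _\<close> by auto
        then have "set_less E E'" using Cons.prems by simp
        moreover have "x \<subseteq> E" "y \<subseteq> E'"
          using Min_in_E(2) Cons.prems(2) E' that(1) by auto
        ultimately show ?thesis by blast
      qed
      with Cons show ?case
        using srtL[of E] by (simp add: sorted_wrt_append)
    qed simp
    have "admissible A Ms"
      unfolding admissible_iff
    proof (intro conjI)
      show "\<forall>M\<in>set Ms. M \<in> fin_pos \<and> M \<noteq> {}"
        using Min_in_E admissible_finite[OF Es(2)] ne by (fastforce simp: Ms_def fin_pos_def)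
      show "sorted_wrt set_less Ms"
        unfolding Ms_def sorted_wrt_map
        by (rule sorted_wrt_mono_rel[OF _ srt]) (use Min_in_E(1) in blast)
      have "Min (Min ` set (L E)) = Min E" if E: "E \<in> set Es" for E
      proof (rule Min_eqI)
        fix y assume "y \<in> Min ` set (L E)"
        then show "Min E \<le> y"
          using Min_in_E(1)[OF E] admissible_finite[OF Es(2) E] by (auto intro: Min_le)
      next
        have "Min E \<in> E" using admissible_finite[OF Es(2) E] by (simp add: Min_in)
        then obtain H where H: "H \<in> set (L E)" "Min E \<in> H" using L(1)[OF E] by blast
        then have "Min H = Min E"
          using Min_in_E[OF E H(1)] admissible_finite[OF Es(2) E]
          by (metis Min_le antisym)
        then show "Min E \<in> Min ` set (L E)" using H(1) by (metis imageI)
      qed simp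
      then show "Min ` set Ms \<in> A"
        using Es(2) by (simp add: Ms_def admissible_iff image_image cong: image_cong)
    qed
    moreover have "set Ms \<subseteq> B"
      using L(2) by (auto simp: Ms_def admissible_def)
    ultimately have "\<Union>(set Ms) \<in> bracket A B" by (rule bracketI)
    moreover have "\<Union>(set Ms) = Min ` set Hs" by (auto simp: Ms_def Hs_def)
    ultimately have "admissible (bracket A B) Hs"
      unfolding admissible_iff using concat_sorted[OF srt] Min_in_E
      by (auto simp: Hs_def fin_pos_def)
    moreover have "set Hs \<subseteq> G" using L(3) by (auto simp: Hs_def)
    moreover have "\<Union>(set Hs) = F"
    proof -
      have "\<Union>(set Hs) = (\<Union>E\<in>set Es. \<Union>(set (L E)))" by (auto simp: Hs_def)
      also have "\<dots> = F"
        unfolding Es(1) using L(1) by (metis (no_types, lifting) SUP_cong image_ident)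
      finally show ?thesis .
    qed
    ultimately show ?thesis using bracketI by metis
  qed (simp add: bracket_empty)
qed

section \<open>Schreier families\<close>

lemma schreier_zero: "schreier \<sigma> 0 = schreier0"
  by (simp add: schreier_def countable_zero ord_rec_0)

lemma schreier_osuc: "\<alpha> < omega1 \<Longrightarrow> schreier \<sigma> (osuc \<alpha>) = bracket schreier1 (schreier \<sigma> \<alpha>)"
  by (simp add: schreier_def countable_osuc ord_rec_osuc)

lemma schreier_limit:
  assumes "schreier_choice \<sigma>" "limit_ord \<delta>" "\<delta> < omega1"
  shows "schreier \<sigma> \<delta> =
    {{}} \<union> {E \<in> fin_pos. E \<noteq> {} \<and> (\<exists>n\<ge>1. n \<le> Min E \<and> E \<in> schreier \<sigma> (osuc (\<sigma> \<delta> n)))}"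
proof -
  have below: "osuc (\<sigma> \<delta> n) < \<delta>" if "1 \<le> n" for n
    using assms that limit_osuc_less[OF assms(2)] unfolding schreier_choice_def by blast
  have "osuc (\<sigma> \<delta> n) < omega1" if "1 \<le> n" for n
    using below[OF that] assms(3) by (rule less_trans)
  then show ?thesis
    using assms(3) below unfolding schreier_def ordinal_add_1
    by (subst ord_rec_limit[OF assms(2)]) (auto simp: Bex_def; metis)+
qed

locale schreier_families =
  fixes \<sigma> :: "ordinal \<Rightarrow> nat \<Rightarrow> ordinal"
  assumes choice: "schreier_choice \<sigma>"
begin

abbreviation Sch :: "ordinal \<Rightarrow> nat set set"
  where "Sch \<equiv> schreier \<sigma>"

lemma choice_less: "limit_ord \<delta> \<Longrightarrow> \<delta> < omega1 \<Longrightarrow> 1 \<le> n \<Longrightarrow> \<sigma> \<delta> n < \<delta>"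
  and choice_cofinal: "limit_ord \<delta> \<Longrightarrow> \<delta> < omega1 \<Longrightarrow> \<beta> < \<delta> \<Longrightarrow> \<exists>n\<ge>1. \<beta> < \<sigma> \<delta> n"
  and choice_nested: "limit_ord \<delta> \<Longrightarrow> \<delta> < omega1 \<Longrightarrow> 1 \<le> n \<Longrightarrow>
    Sch (osuc (\<sigma> \<delta> n)) \<subseteq> Sch (\<sigma> \<delta> (Suc n))"
  using choice unfolding schreier_choice_def ordinal_add_1 by blast+

lemma Sch_limitI:
  assumes "limit_ord \<delta>" "\<delta> < omega1" "1 \<le> n" "F \<in> Sch (osuc (\<sigma> \<delta> n))" "F \<in> fin_pos"
    and "\<And>x. x \<in> F \<Longrightarrow> n \<le> x"
  shows "F \<in> Sch \<delta>"
proof (cases "F = {}")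
  case False
  have "finite F" using assms(5) by (simp add: fin_pos_def)
  then have "n \<le> Min F" using False assms(6) by simp
  then show ?thesis
    using assms(3-5) False unfolding schreier_limit[OF choice assms(1,2)] by blast
qed (simp add: schreier_limit[OF choice assms(1,2)])

lemma Sch_limitD:
  assumes "limit_ord \<delta>" "\<delta> < omega1" "F \<in> Sch \<delta>" "F \<noteq> {}"
  obtains n where "1 \<le> n" "F \<in> Sch (osuc (\<sigma> \<delta> n))" "F \<in> fin_pos" "\<And>x. x \<in> F \<Longrightarrow> n \<le> x"
proof -
  obtain n where n: "1 \<le> n" "n \<le> Min F" "F \<in> Sch (osuc (\<sigma> \<delta> n))" "F \<in> fin_pos"
    using assms(3,4) unfolding schreier_limit[OF choice assms(1,2)] by blast
  then have "n \<le> x" if "x \<in> F" for x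
    using Min_le[OF _ that] by (simp add: fin_pos_def)
  with n that show ?thesis by blast
qed

lemma regular_Sch: "\<alpha> < omega1 \<Longrightarrow> regular_family (Sch \<alpha>)"
proof (induction \<alpha> rule: ordinal_induct)
  case zero
  show ?case by (simp add: schreier_zero regular_schreier0)
next
  case (osuc \<alpha>)
  with osuc_less_omega1D[OF osuc.prems] show ?case
    by (simp add: schreier_osuc regular_bracket regular_schreier1)
next
  case (limit \<delta>)
  note sch = schreier_limit[OF choice limit(1,3)]
  have reg: "regular_family (Sch (osuc (\<sigma> \<delta> n)))" if "1 \<le> n" for n
    using limit(2) limit_osuc_less[OF limit(1) choice_less[OF limit(1,3) that]] limit(3) less_trans
    by blast
  have "hereditary (Sch \<delta>)"
    unfolding hereditary_def
  proof (intro ballI allI impI)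
    fix F G assume FG: "F \<in> Sch \<delta>" "G \<subseteq> F"
    show "G \<in> Sch \<delta>"
    proof (cases "F = {}")
      case False
      then obtain n where n: "1 \<le> n" "F \<in> Sch (osuc (\<sigma> \<delta> n))" "F \<in> fin_pos" "\<And>x. x \<in> F \<Longrightarrow> n \<le> x"
        using FG Sch_limitD[OF limit(1,3)] by metis
      have "G \<in> Sch (osuc (\<sigma> \<delta> n))"
        using regular_subset[OF reg[OF n(1)] n(2) FG(2)] .
      moreover from this have "G \<in> fin_pos" by (rule regular_fin_pos[OF reg[OF n(1)]])
      ultimately show ?thesis
        using Sch_limitI[OF limit(1,3) n(1)] n(4) FG(2) by blast
    qed (use FG sch in simp)
  qed
  moreover have "spreading (Sch \<delta>)"
    unfolding spreading_def
  proof (intro ballI allI impI)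
    fix F f assume F: "F \<in> Sch \<delta>" and f: "strict_mono_on F f" "\<forall>x\<in>F. x \<le> f x"
    show "f ` F \<in> Sch \<delta>"
    proof (cases "F = {}")
      case False
      then obtain n where n: "1 \<le> n" "F \<in> Sch (osuc (\<sigma> \<delta> n))" "F \<in> fin_pos" "\<And>x. x \<in> F \<Longrightarrow> n \<le> x"
        using F Sch_limitD[OF limit(1,3)] by metis
      have im: "f ` F \<in> Sch (osuc (\<sigma> \<delta> n))"
        using regular_spreading[OF reg[OF n(1)]] n(2) f unfolding spreading_def by blast
      moreover from this have "f ` F \<in> fin_pos" by (rule regular_fin_pos[OF reg[OF n(1)]])
      ultimately show ?thesis
        by (rule Sch_limitI[OF limit(1,3) n(1)]) (use n(4) f(2) order_trans in blast)
    qed (use F sch in simp)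
  qed
  moreover have "{n} \<in> Sch \<delta>" if "1 \<le> n" for n
    by (rule Sch_limitI[OF limit(1,3), of 1])
      (use that regular_singleton[OF reg[of 1]] in \<open>auto simp: fin_pos_def\<close>)
  moreover have "Sch \<delta> \<subseteq> fin_pos"
    unfolding sch by (auto simp: fin_pos_def)
  ultimately show ?case by (simp add: regular_family_def)
qed

lemma Sch_subset_osuc: "\<alpha> < omega1 \<Longrightarrow> Sch \<alpha> \<subseteq> Sch (osuc \<alpha>)"
  by (simp add: schreier_osuc subset_bracket regular_schreier1 regular_Sch)

text \<open>
  At a limit \<open>\<delta>\<close> the family of some index \<open>\<sigma> \<delta> n + 1\<close> above \<open>\<alpha>\<close> is contained in \<open>Sch \<delta>\<close> except for sets
  that start before \<open>n\<close>; a shift by \<open>n\<close> removes the exception.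
\<close>

lemma embeds_Sch_mono: "\<alpha> \<le> \<beta> \<Longrightarrow> \<beta> < omega1 \<Longrightarrow> embeds (Sch \<alpha>) (Sch \<beta>)"
proof (induction \<beta> rule: ordinal_induct)
  case zero
  then have "\<alpha> = 0" using zero_le_ordinal antisym by blast
  then show ?case by (simp add: embeds_subset)
next
  case (osuc \<beta>)
  show ?case
  proof (cases "\<alpha> = osuc \<beta>")
    case False
    with osuc(2) have "\<alpha> \<le> \<beta>" by (metis less_osuc_iff order_le_less)
    with osuc(1,3) show ?thesis
      using embeds_trans embeds_subset[OF Sch_subset_osuc] osuc_less_omega1D by blast
  qed (simp add: embeds_subset)
next
  case (limit \<delta>)
  show ?case
  proof (cases "\<alpha> = \<delta>")
    case False
    with limit have "\<alpha> < \<delta>" by simp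
    then obtain n where n: "1 \<le> n" "\<alpha> < \<sigma> \<delta> n"
      using choice_cofinal limit by blast
    have below: "osuc (\<sigma> \<delta> n) < \<delta>"
      using limit_osuc_less[OF limit(1) choice_less[OF limit(1,4) n(1)]] .
    have "embeds (Sch \<alpha>) (Sch (osuc (\<sigma> \<delta> n)))"
      by (rule limit(2)[OF below]) (use n below limit(4) less_osuc[of "\<sigma> \<delta> n"] in auto)
    then obtain \<phi> :: "nat \<Rightarrow> nat" where \<phi>: "strict_mono \<phi>" "\<forall>F\<in>Sch \<alpha>. \<phi> ` F \<in> Sch (osuc (\<sigma> \<delta> n))"
      unfolding embeds_def by blast
    have reg: "regular_family (Sch (osuc (\<sigma> \<delta> n)))"
      using below limit(4) by (intro regular_Sch) simp
    have "(\<lambda>i. \<phi> i + n) ` F \<in> Sch \<delta>" if F: "F \<in> Sch \<alpha>" for F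
    proof -
      have "(\<lambda>i. \<phi> i + n) ` F \<in> Sch (osuc (\<sigma> \<delta> n))"
        by (rule spreading_dominate[OF regular_spreading[OF reg], of \<phi>])
          (use \<phi> F in \<open>auto simp: strict_mono_on_def strict_mono_def\<close>)
      moreover from this have "(\<lambda>i. \<phi> i + n) ` F \<in> fin_pos"
        by (rule regular_fin_pos[OF reg])
      ultimately show ?thesis
        by (rule Sch_limitI[OF limit(1,4) n(1)]) auto
    qed
    moreover have "strict_mono (\<lambda>i. \<phi> i + n)"
      using \<phi>(1) by (simp add: strict_mono_def)
    ultimately show ?thesis unfolding embeds_def by blast
  qed (simp add: embeds_subset)
qed

text \<open>
  Induction on \<open>\<alpha>\<close>.  The successor step is associativity of the bracket.  At a limit \<open>\<delta>\<close>, the approximating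
  sequence of \<open>\<beta> + \<delta>\<close> is unrelated to that of \<open>\<delta>\<close>, but each of its terms lies below some \<open>\<beta> + \<eta>\<close> with
  \<open>\<eta> < \<delta>\<close>, and the embeddings obtained for the terms are diagonalised.
\<close>

lemma embeds_Sch_add:
  "\<beta> < omega1 \<Longrightarrow> \<alpha> < omega1 \<Longrightarrow> embeds (Sch (\<beta> + \<alpha>)) (bracket (Sch \<alpha>) (Sch \<beta>))"
proof (induction \<alpha> rule: ordinal_induct)
  case zero
  then show ?case
    by (simp add: add_zero schreier_zero embeds_subset subset_bracket regular_schreier0 regular_Sch)
next
  case (osuc \<alpha>)
  then have \<alpha>: "\<alpha> < omega1" using osuc_less_omega1D by blast
  have "embeds (bracket schreier1 (Sch (\<beta> + \<alpha>))) (bracket schreier1 (bracket (Sch \<alpha>) (Sch \<beta>)))"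
    using osuc \<alpha> by (intro embeds_bracket regular_schreier1 regular_Sch regular_bracket countable_add
        embeds_refl) auto
  then show ?case
    using osuc \<alpha> embeds_trans[OF _ embeds_subset[OF bracket_assoc]]
    by (simp add: add_osuc schreier_osuc countable_add)
next
  case (limit \<delta>)
  define \<gamma> where "\<gamma> = \<beta> + \<delta>"
  have \<gamma>: "limit_ord \<gamma>" "\<gamma> < omega1"
    using limit by (simp_all add: \<gamma>_def limit_add countable_add)
  \<comment> \<open>The approximating sequence starts at index \<open>1\<close>, so the family of index \<open>0\<close> is empty.\<close>
  define A where "A n = (if n = 0 then {} else Sch (osuc (\<sigma> \<gamma> n)))" for n
  have reg: "regular_family (bracket (Sch \<delta>) (Sch \<beta>))"
    using limit by (intro regular_bracket regular_Sch)
  have "embeds (A n) (bracket (Sch \<delta>) (Sch \<beta>))" for n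
  proof (cases "n = 0")
    case False
    have "osuc (\<sigma> \<gamma> n) < \<beta> + \<delta>"
      using limit_osuc_less[OF \<gamma>(1) choice_less[OF \<gamma>]] False by (simp add: \<gamma>_def)
    then obtain \<eta> where \<eta>: "\<eta> < \<delta>" "osuc (\<sigma> \<gamma> n) < \<beta> + \<eta>"
      using less_add_limitD[OF limit(1)] by blast
    have \<eta>1: "\<eta> < omega1" using \<eta>(1) limit(4) by (rule less_trans)
    have "embeds (A n) (Sch (\<beta> + \<eta>))"
      using False \<eta> \<eta>1 limit(3) by (simp add: A_def embeds_Sch_mono countable_add)
    moreover have "embeds (Sch (\<beta> + \<eta>)) (bracket (Sch \<eta>) (Sch \<beta>))"
      using limit(2)[OF \<eta>(1) limit(3) \<eta>1] .
    moreover have "embeds (bracket (Sch \<eta>) (Sch \<beta>)) (bracket (Sch \<delta>) (Sch \<beta>))"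
      using \<eta> \<eta>1 limit(3,4) by (intro embeds_bracket regular_Sch embeds_Sch_mono embeds_refl) auto
    ultimately show ?thesis using embeds_trans by blast
  qed (simp add: A_def embeds_subset)
  moreover have "\<exists>n. F \<in> A n \<and> (\<forall>x\<in>F. n \<le> x)" if F: "F \<in> Sch \<gamma>" "F \<noteq> {}" for F
    using Sch_limitD[OF \<gamma> F] unfolding A_def by (metis not_one_le_zero)
  ultimately show ?case
    unfolding \<gamma>_def[symmetric] by (rule embeds_diagonal[OF reg])
qed

lemma embeds_Sch_mult:
  assumes "\<alpha> < omega1"
  shows "embeds (Sch (\<alpha> * ord_of_nat N)) ((bracket (Sch \<alpha>) ^^ N) schreier0)"
proof (induction N)
  case 0
  show ?case by (simp add: mult_zero schreier_zero embeds_refl)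
next
  case (Suc N)
  have reg: "regular_family ((bracket (Sch \<alpha>) ^^ n) schreier0)" for n
    by (induction n) (simp_all add: regular_schreier0 regular_bracket regular_Sch assms)
  have n: "ord_of_nat N < omega1"
    by (rule less_trans[OF _ countable_omega]) (auto simp: less_omega_iff)
  have \<beta>: "\<alpha> * ord_of_nat N < omega1"
    by (rule countable_mult[OF assms n])
  have "embeds (Sch (\<alpha> * ord_of_nat (Suc N))) (bracket (Sch \<alpha>) (Sch (\<alpha> * ord_of_nat N)))"
    using embeds_Sch_add[OF \<beta> assms] by (simp add: mult_osuc)
  moreover have "embeds (bracket (Sch \<alpha>) (Sch (\<alpha> * ord_of_nat N)))
      (bracket (Sch \<alpha>) ((bracket (Sch \<alpha>) ^^ N) schreier0))"
    by (rule embeds_bracket[OF regular_Sch[OF assms] regular_Sch[OF \<beta>] embeds_refl Suc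
          regular_Sch[OF assms] reg])
  ultimately show ?case
    unfolding funpow.simps(2) o_apply by (rule embeds_trans)
qed

end

section \<open>Derivatives of trees\<close>

lemma tree_derivative_iff: "t \<in> tree_derivative T \<longleftrightarrow> t \<in> T \<and> (\<exists>s\<in>T. strict_prefix t s)"
  by (auto simp: tree_derivative_def)

lemma tree_derivatives_zero: "tree_derivatives 0 T = T"
  by (simp add: tree_derivatives_def ord_rec_0)

lemma tree_derivatives_osuc: "tree_derivatives (osuc \<alpha>) T = tree_derivative (tree_derivatives \<alpha> T)"
  by (simp add: tree_derivatives_def ord_rec_osuc)

lemma tree_derivatives_limit:
  "limit_ord \<delta> \<Longrightarrow> tree_derivatives \<delta> T = (\<Inter>\<zeta>\<in>{..<\<delta>}. tree_derivatives \<zeta> T)"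
  unfolding tree_derivatives_def by (subst ord_rec_limit) auto

lemma tree_derivatives_antimono: "\<alpha> \<le> \<beta> \<Longrightarrow> tree_derivatives \<beta> T \<subseteq> tree_derivatives \<alpha> T"
proof (induction \<beta> rule: ordinal_induct)
  case zero
  then have "\<alpha> = 0" using zero_le_ordinal antisym by blast
  then show ?case by simp
next
  case (osuc \<beta>)
  show ?case
  proof (cases "\<alpha> = osuc \<beta>")
    case False
    with osuc.prems have "\<alpha> \<le> \<beta>" by (metis less_osuc_iff order_le_less)
    with osuc.IH show ?thesis
      unfolding tree_derivatives_osuc tree_derivative_def by blast
  qed simp
next
  case (limit \<delta>)
  then show ?case
    by (cases "\<alpha> = \<delta>") (auto simp: tree_derivatives_limit[of \<delta>])
qed

lemma tree_derivatives_subset: "tree_derivatives \<alpha> T \<subseteq> T"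
  using tree_derivatives_antimono[OF zero_le_ordinal] by (auto simp: tree_derivatives_zero)

lemma tree_derivatives_add: "tree_derivatives (\<alpha> + \<beta>) T \<subseteq> tree_derivatives \<beta> (tree_derivatives \<alpha> T)"
proof (induction \<beta> rule: ordinal_induct)
  case zero
  show ?case by (simp add: add_zero tree_derivatives_zero)
next
  case (osuc \<beta>)
  then show ?case
    unfolding add_osuc tree_derivatives_osuc by (intro subsetI) (meson subsetD tree_derivative_iff)
next
  case (limit \<delta>)
  have "tree_derivatives (\<alpha> + \<delta>) T \<subseteq> tree_derivatives (\<alpha> + \<beta>) T" if "\<beta> < \<delta>" for \<beta>
    by (rule tree_derivatives_antimono) (use that add_mono_right in auto)
  with limit show ?case by (auto simp: tree_derivatives_limit[of \<delta>])
qed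

text \<open>
  Rank does not decrease under maps that preserve strict extension of sequences.
\<close>

lemma tree_derivatives_image:
  assumes "h ` T \<subseteq> T'" and "\<And>s t. s \<in> T \<Longrightarrow> t \<in> T \<Longrightarrow> strict_prefix s t \<Longrightarrow> strict_prefix (h s) (h t)"
  shows "h ` tree_derivatives \<alpha> T \<subseteq> tree_derivatives \<alpha> T'"
proof (induction \<alpha> rule: ordinal_induct)
  case zero
  show ?case using assms(1) by (simp add: tree_derivatives_zero)
next
  case (osuc \<alpha>)
  show ?case
  proof
    fix u assume "u \<in> h ` tree_derivatives (osuc \<alpha>) T"
    then obtain s t where st: "u = h s" "s \<in> tree_derivatives \<alpha> T" "t \<in> tree_derivatives \<alpha> T"
      "strict_prefix s t"
      unfolding tree_derivatives_osuc by (auto simp: tree_derivative_iff)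
    then have "strict_prefix (h s) (h t)"
      using assms(2) tree_derivatives_subset by blast
    then show "u \<in> tree_derivatives (osuc \<alpha>) T'"
      using st osuc unfolding tree_derivatives_osuc tree_derivative_iff by blast
  qed
next
  case (limit \<delta>)
  then show ?case unfolding tree_derivatives_limit[OF limit(1)] by blast
qed

lemma tree_order_greaterD:
  assumes "tree_order T > Fin \<alpha>"
  shows "tree_derivatives \<alpha> T \<noteq> {}"
proof
  assume "tree_derivatives \<alpha> T = {}"
  then have "tree_order T = Fin (LEAST \<xi>. tree_derivatives \<xi> T = {})"
    and "(LEAST \<xi>. tree_derivatives \<xi> T = {}) \<le> \<alpha>"
    by (auto simp: tree_order_def intro: Least_le)
  with assms show False by simp
qed

section \<open>Repeated averages on trees\<close>

definition weights :: "nat list \<Rightarrow> real \<Rightarrow> (nat \<Rightarrow> real) \<Rightarrow> bool"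
  where "weights s m w \<longleftrightarrow> (\<forall>i. 0 \<le> w i) \<and> (\<forall>i. i \<notin> set s \<longrightarrow> w i = 0) \<and> sum w (set s) = m"

lemma weights_sum_le:
  assumes "weights s m w" "finite F"
  shows "sum w F \<le> m"
proof -
  have "sum w F = sum w (F \<inter> set s)"
    using assms by (intro sum.mono_neutral_right) (auto simp: weights_def)
  also have "\<dots> \<le> sum w (set s)"
    using assms by (intro sum_mono2) (auto simp: weights_def)
  finally show ?thesis using assms by (simp add: weights_def)
qed

lemma weights_disjoint: "weights s m w \<Longrightarrow> F \<inter> set s = {} \<Longrightarrow> sum w F = 0"
  unfolding weights_def by (intro sum.neutral) blast

lemma weights_add:
  assumes "weights s m v" "weights t n w" "prefix s t"
  shows "weights t (m + n) (\<lambda>i. v i + w i)"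
proof -
  have sub: "set s \<subseteq> set t" using assms(3) by (rule set_mono_prefix)
  then have "sum v (set t) = m"
    using assms(1) sum.mono_neutral_right[of "set t" "set s" v] by (auto simp: weights_def)
  then show ?thesis
    using assms sub by (auto simp: weights_def sum.distrib)
qed

lemma weights_scale: "weights s m w \<Longrightarrow> 0 \<le> c \<Longrightarrow> weights s (c * m) (\<lambda>i. c * w i)"
  by (auto simp: weights_def sum_distrib_left[symmetric])

text \<open>
  Given \<open>\<delta> > 0\<close>, a node of rank at least \<open>\<alpha>\<close> in a tree of sequences without repetitions extends to a branch
  carrying a probability that is at most \<open>\<delta>\<close> on all members of \<open>\<S>\<close>, in the first notion only on those that
  start at or before a prescribed \<open>p\<close>.  The first is what a block needs when it is placed after \<open>p\<close>; the
  second is the aim.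
\<close>

definition late_averages :: "nat set set \<Rightarrow> ordinal \<Rightarrow> bool"
  where "late_averages \<S> \<alpha> \<longleftrightarrow> (\<forall>(T::nat list set) t (p::nat) (\<delta>::real). (\<forall>s\<in>T. distinct s) \<longrightarrow> t \<in> tree_derivatives \<alpha> T \<longrightarrow> 0 < \<delta> \<longrightarrow>
    (\<exists>s\<in>T. \<exists>w. prefix t s \<and> weights s 1 w \<and> (\<forall>F\<in>\<S>. (\<exists>x\<in>F. x \<le> p) \<longrightarrow> sum w F \<le> \<delta>)))"

definition small_averages :: "nat set set \<Rightarrow> ordinal \<Rightarrow> bool"
  where "small_averages \<S> \<alpha> \<longleftrightarrow> (\<forall>(T::nat list set) t (\<delta>::real). (\<forall>s\<in>T. distinct s) \<longrightarrow> t \<in> tree_derivatives \<alpha> T \<longrightarrow> 0 < \<delta> \<longrightarrow>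
    (\<exists>s\<in>T. \<exists>w. prefix t s \<and> weights s 1 w \<and> (\<forall>F\<in>\<S>. sum w F \<le> \<delta>)))"

lemma late_averagesD:
  "\<lbrakk>late_averages \<S> \<alpha>; \<forall>s\<in>T. distinct s; t \<in> tree_derivatives \<alpha> T; 0 < \<delta>\<rbrakk> \<Longrightarrow>
    \<exists>s\<in>T. \<exists>w. prefix t s \<and> weights s 1 w \<and> (\<forall>F\<in>\<S>. (\<exists>x\<in>F. x \<le> p) \<longrightarrow> sum w F \<le> \<delta>)"
  unfolding late_averages_def by simp

lemma small_averagesD:
  "\<lbrakk>small_averages \<S> \<alpha>; \<forall>s\<in>T. distinct s; t \<in> tree_derivatives \<alpha> T; 0 < \<delta>\<rbrakk> \<Longrightarrow>
    \<exists>s\<in>T. \<exists>w. prefix t s \<and> weights s 1 w \<and> (\<forall>F\<in>\<S>. sum w F \<le> \<delta>)"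
  unfolding small_averages_def by simp

text \<open>
  Stack \<open>n\<close> late averages, each taken relative to the end of the previous one.  A set in the
  family may swallow the block in which it starts, but it is almost negligible on every later block.
\<close>

lemma late_averages_blocks:
  fixes \<delta> :: real and p :: nat
  assumes fin: "\<forall>F\<in>\<S>. finite F" and late: "late_averages \<S> \<alpha>"
    and T: "\<forall>s\<in>T. distinct (s :: nat list)" and \<delta>: "0 < \<delta>"
  shows "t \<in> tree_derivatives (\<alpha> * ord_of_nat n) T \<Longrightarrow> \<exists>s\<in>T. \<exists>w. prefix t s \<and> weights s n w \<and>
    (\<forall>F\<in>\<S>. sum w F \<le> 1 + n * \<delta>) \<and> (\<forall>F\<in>\<S>. (\<exists>x\<in>F. x \<le> p) \<longrightarrow> sum w F \<le> n * \<delta>)"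
proof (induction n arbitrary: t p)
  case 0
  then have "t \<in> T" by (simp add: mult_zero tree_derivatives_zero)
  then show ?case by (intro bexI[of _ t] exI[of _ "\<lambda>_. 0"]) (auto simp: weights_def)
next
  case (Suc n)
  let ?T = "tree_derivatives (\<alpha> * ord_of_nat n) T"
  have t: "t \<in> tree_derivatives \<alpha> ?T"
    using Suc.prems tree_derivatives_add by (auto simp: mult_osuc)
  have dist: "\<forall>s\<in>?T. distinct s"
    using T tree_derivatives_subset by blast
  obtain t' v where t': "t' \<in> ?T" "prefix t t'" "weights t' 1 v"
    and v: "\<forall>F\<in>\<S>. (\<exists>x\<in>F. x \<le> p) \<longrightarrow> sum v F \<le> \<delta>"
    using late_averagesD[OF late dist t \<delta>, where p = p] by (elim bexE exE conjE)
  \<comment> \<open>The remaining blocks have to be negligible for every set that meets the block just chosen.\<close>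
  define q where "q = Max (insert p (set t'))"
  have q: "x \<le> q" if "x \<in> set t' \<or> x \<le> p" for x
    using that Max_ge[of "insert p (set t')" x] Max_ge[of "insert p (set t')" p]
    unfolding q_def by (auto intro: le_trans)
  obtain s w where s: "s \<in> T" "prefix t' s" "weights s n w"
    and w1: "\<forall>F\<in>\<S>. sum w F \<le> 1 + n * \<delta>"
    and w2: "\<forall>F\<in>\<S>. (\<exists>x\<in>F. x \<le> q) \<longrightarrow> sum w F \<le> n * \<delta>"
    using Suc.IH[OF t'(1), of q] by (elim bexE exE conjE)
  have "sum (\<lambda>i. v i + w i) F \<le> 1 + Suc n * \<delta>" if F: "F \<in> \<S>" for F
  proof (cases "F \<inter> set t' = {}")
    case True
    then show ?thesis
      using weights_disjoint[OF t'(3) True] bspec[OF w1 F] \<delta> by (simp add: sum.distrib algebra_simps)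
  next
    case False
    then have "sum w F \<le> n * \<delta>" using w2 F q by blast
    then show ?thesis
      using weights_sum_le[OF t'(3) bspec[OF fin F]] \<delta> by (simp add: sum.distrib algebra_simps)
  qed
  moreover have "sum (\<lambda>i. v i + w i) F \<le> Suc n * \<delta>" if F: "F \<in> \<S>" "\<exists>x\<in>F. x \<le> p" for F
  proof -
    have "sum w F \<le> n * \<delta>" using w2 F q by blast
    then show ?thesis using bspec[OF v F(1)] F(2) by (auto simp: sum.distrib algebra_simps)
  qed
  moreover have "prefix t s" using t'(2) s(2) by (rule prefix_order.trans)
  moreover have "weights s (Suc n) (\<lambda>i. v i + w i)"
    using weights_add[OF t'(3) s(3,2)] by simp
  ultimately show ?case using s(1) by blast
qed

text \<open>
  The mean of \<open>n\<close> blocks gives weight at most \<open>1/n\<close> to the block that is swallowed and at most the prescribed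
  bound to the rest.  A node of rank \<open>\<omega>\<^bsup>\<alpha>+1\<^esup>\<close> has rank at least \<open>\<omega>\<^sup>\<alpha> \<cdot> n\<close> for every \<open>n\<close>.
\<close>

lemma small_averagesI:
  assumes fin: "\<forall>F\<in>\<S>. finite F" and late: "late_averages \<S> (omega_pow \<alpha>)"
  shows "small_averages \<S> (omega_pow (osuc \<alpha>))"
  unfolding small_averages_def
proof (intro allI impI)
  fix T :: "nat list set" and t and \<delta> :: real
  assume T: "\<forall>s\<in>T. distinct s" and t: "t \<in> tree_derivatives (omega_pow (osuc \<alpha>)) T" and \<delta>: "0 < \<delta>"
  obtain n :: nat where n: "2 / \<delta> < n" using reals_Archimedean2 by blast
  with \<delta> have n0: "0 < real n" by (smt (verit) divide_pos_pos)
  have t': "t \<in> tree_derivatives (omega_pow \<alpha> * ord_of_nat n) T"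
    using t tree_derivatives_antimono[OF omega_pow_osuc_upper] by blast
  have "0 < \<delta> / 2" using \<delta> by simp
  obtain s w where s: "s \<in> T" "prefix t s" "weights s n w"
    and w: "\<forall>F\<in>\<S>. sum w F \<le> 1 + n * (\<delta> / 2)"
    using late_averages_blocks[OF fin late T \<open>0 < \<delta> / 2\<close> t', of 0] by (elim bexE exE conjE)
  have "weights s 1 (\<lambda>i. 1 / n * w i)"
    using weights_scale[OF s(3), of "1 / n"] n0 by simp
  moreover have "sum (\<lambda>i. 1 / n * w i) F \<le> \<delta>" if F: "F \<in> \<S>" for F
  proof -
    have "sum (\<lambda>i. 1 / n * w i) F = 1 / n * sum w F"
      by (simp add: sum_distrib_left)
    also have "\<dots> \<le> 1 / n * (1 + n * (\<delta> / 2))"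
      using bspec[OF w F] by (intro mult_left_mono) auto
    also have "\<dots> \<le> \<delta>"
      using n n0 \<delta> by (simp add: field_simps)
    finally show ?thesis .
  qed
  ultimately show "\<exists>s\<in>T. \<exists>w. prefix t s \<and> weights s 1 w \<and> (\<forall>F\<in>\<S>. sum w F \<le> \<delta>)"
    using s(1,2) by blast
qed

text \<open>
  A node of rank \<open>\<omega>\<close> has arbitrarily long extensions, on which the uniform weight of a single point is small.
\<close>

lemma small_averages_schreier0: "small_averages schreier0 (omega_pow (osuc 0))"
  unfolding small_averages_def
proof (intro allI impI)
  fix T :: "nat list set" and t and \<delta> :: real
  assume T: "\<forall>s\<in>T. distinct s" and t: "t \<in> tree_derivatives (omega_pow (osuc 0)) T" and \<delta>: "0 < \<delta>"
  have long: "\<exists>s\<in>T. prefix t s \<and> length t + n \<le> length s"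
    if "t \<in> tree_derivatives (1 * ord_of_nat n) T" for n t
    using that
  proof (induction n arbitrary: t)
    case 0
    then show ?case by (auto simp: mult_zero tree_derivatives_zero)
  next
    case (Suc n)
    then have "t \<in> tree_derivative (tree_derivatives (1 * ord_of_nat n) T)"
      by (simp add: mult_osuc ordinal_add_1 tree_derivatives_osuc)
    then obtain t' where t': "t' \<in> tree_derivatives (1 * ord_of_nat n) T" "strict_prefix t t'"
      by (auto simp: tree_derivative_iff)
    from Suc.IH[OF t'(1)] obtain s where "s \<in> T" "prefix t' s" "length t' + n \<le> length s" by blast
    moreover have "length t < length t'" using t'(2) by (rule prefix_length_less)
    moreover have "prefix t s"
      using t'(2) \<open>prefix t' s\<close> by (meson prefix_order.less_imp_le prefix_order.trans)
    ultimately show ?case by (intro bexI[of _ s]) auto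
  qed
  obtain n :: nat where n: "1 / \<delta> < n" using reals_Archimedean2 by blast
  have "t \<in> tree_derivatives (1 * ord_of_nat n) T"
    using t tree_derivatives_antimono[OF omega_pow_osuc_upper[of 0 n]] by (auto simp: omega_pow_zero)
  then obtain s where s: "s \<in> T" "prefix t s" "n \<le> length s"
    using long by fastforce
  let ?k = "card (set s)"
  have k: "?k = length s" using T s(1) by (simp add: distinct_card)
  have k\<delta>: "1 / \<delta> < ?k" using n s(3) k by simp
  then have k0: "0 < real ?k" using \<delta> by (smt (verit) divide_pos_pos)
  define w where "w i = (if i \<in> set s then 1 / real ?k else 0)" for i
  have "weights s 1 w"
    using k0 by (auto simp: weights_def w_def)
  moreover have "sum w F \<le> \<delta>" if F: "F \<in> schreier0" for F
  proof -
    have "sum w F \<le> (\<Sum>i\<in>F. 1 / ?k)" by (intro sum_mono) (simp add: w_def)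
    also have "\<dots> = card F * (1 / ?k)" by simp
    also have "\<dots> \<le> 1 * (1 / ?k)"
      using F by (intro mult_right_mono) (auto simp: schreier0_def)
    also have "\<dots> \<le> \<delta>" using k\<delta> k0 \<delta> by (simp add: field_simps)
    finally show ?thesis .
  qed
  ultimately show "\<exists>s\<in>T. \<exists>w. prefix t s \<and> weights s 1 w \<and> (\<forall>F\<in>schreier0. sum w F \<le> \<delta>)"
    using s by blast
qed

context schreier_families
begin

text \<open>
  A member of \<open>Sch (osuc \<alpha>)\<close> that starts at or before \<open>p\<close> is a union of at most \<open>p\<close> members of \<open>Sch \<alpha>\<close>.
\<close>

lemma late_averages_osuc:
  assumes "\<alpha> < omega1" and small: "small_averages (Sch \<alpha>) (omega_pow (osuc \<alpha>))"
  shows "late_averages (Sch (osuc \<alpha>)) (omega_pow (osuc \<alpha>))"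
  unfolding late_averages_def
proof (intro allI impI)
  fix T :: "nat list set" and t and p :: nat and \<delta> :: real
  assume T: "\<forall>s\<in>T. distinct s" and t: "t \<in> tree_derivatives (omega_pow (osuc \<alpha>)) T" and \<delta>: "0 < \<delta>"
  \<comment> \<open>The denominator \<open>p + 1\<close> avoids a division by zero for \<open>p = 0\<close>.\<close>
  define \<epsilon> where "\<epsilon> = \<delta> / (p + 1)"
  have \<epsilon>: "0 < \<epsilon>" "p * \<epsilon> \<le> \<delta>" using \<delta> by (simp_all add: \<epsilon>_def field_simps)
  obtain s w where s: "s \<in> T" "prefix t s" "weights s 1 w" and w: "\<forall>F\<in>Sch \<alpha>. sum w F \<le> \<epsilon>"
    using small_averagesD[OF small T t \<epsilon>(1)] by (elim bexE exE conjE)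
  have "sum w F \<le> \<delta>" if F: "F \<in> Sch (osuc \<alpha>)" and x: "x \<in> F" "x \<le> p" for F x
  proof -
    have "F \<in> bracket schreier1 (Sch \<alpha>)" "F \<noteq> {}"
      using F x assms(1) by (auto simp: schreier_osuc)
    then obtain Es where Es: "F = \<Union>(set Es)" "admissible schreier1 Es" "set Es \<subseteq> Sch \<alpha>"
      by (rule bracketE)
    obtain E where E: "E \<in> set Es" "x \<in> E" using x(1) Es(1) by blast
    have ad: "Min ` set Es \<in> schreier1" using Es(2) by (simp add: admissible_def)
    have "card (set Es) = card (Min ` set Es)"
      using card_image[OF admissible_inj_Min[OF Es(2)]] by simp
    also have "\<dots> \<le> Min (Min ` set Es)"
      using ad E(1) by (auto simp: schreier1_def)
    also have "\<dots> \<le> Min E" using E(1) by (intro Min_le) auto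
    also have "\<dots> \<le> x" using E admissible_finite[OF Es(2)] by (intro Min_le) auto
    finally have card: "card (set Es) \<le> p" using x(2) by simp
    have "sum w F = (\<Sum>E\<in>set Es. sum w E)"
      unfolding Es(1) by (rule admissible_sum_Union[OF Es(2)])
    also have "\<dots> \<le> (\<Sum>E\<in>set Es. \<epsilon>)"
      using w Es(3) by (intro sum_mono) auto
    also have "\<dots> \<le> p * \<epsilon>"
      using card \<epsilon>(1) by simp
    finally show ?thesis using \<epsilon>(2) by simp
  qed
  then show "\<exists>s\<in>T. \<exists>w. prefix t s \<and> weights s 1 w \<and> (\<forall>F\<in>Sch (osuc \<alpha>). (\<exists>x\<in>F. x \<le> p) \<longrightarrow> sum w F \<le> \<delta>)"
    using s by blast
qed

lemma Sch_choice_mono: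
  assumes \<delta>: "limit_ord \<delta>" "\<delta> < omega1" and "1 \<le> m" "m \<le> n"
  shows "Sch (osuc (\<sigma> \<delta> m)) \<subseteq> Sch (osuc (\<sigma> \<delta> n))"
  using assms(4)
proof (induction n rule: dec_induct)
  case (step n)
  then have "1 \<le> n" using assms(3) by simp
  then have "Sch (osuc (\<sigma> \<delta> n)) \<subseteq> Sch (\<sigma> \<delta> (Suc n))"
    by (rule choice_nested[OF \<delta>])
  also have "\<dots> \<subseteq> Sch (osuc (\<sigma> \<delta> (Suc n)))"
    using choice_less[OF \<delta>, of "Suc n"] \<delta>(2) by (intro Sch_subset_osuc) auto
  finally show ?case using step.IH by blast
qed simp

text \<open>
  The members of \<open>Sch \<delta>\<close> starting at or before \<open>p\<close> all belong to a single family of index below \<open>\<delta>\<close>.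
\<close>

lemma late_averages_limit:
  assumes \<delta>: "limit_ord \<delta>" "\<delta> < omega1"
    and small: "\<And>\<alpha>. \<alpha> < \<delta> \<Longrightarrow> small_averages (Sch \<alpha>) (omega_pow (osuc \<alpha>))"
  shows "late_averages (Sch \<delta>) (omega_pow \<delta>)"
  unfolding late_averages_def
proof (intro allI impI)
  fix T :: "nat list set" and t and p :: nat and \<epsilon> :: real
  assume T: "\<forall>s\<in>T. distinct s" and t: "t \<in> tree_derivatives (omega_pow \<delta>) T" and \<epsilon>: "0 < \<epsilon>"
  define \<alpha> where "\<alpha> = osuc (\<sigma> \<delta> (max 1 p))"
  have \<alpha>: "\<alpha> < \<delta>"
    unfolding \<alpha>_def by (intro limit_osuc_less[OF \<delta>(1)] choice_less[OF \<delta>]) simp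
  then have "omega_pow (osuc \<alpha>) \<le> omega_pow \<delta>"
    by (intro omega_pow_mono less_imp_le limit_osuc_less[OF \<delta>(1)])
  then have t': "t \<in> tree_derivatives (omega_pow (osuc \<alpha>)) T"
    using t tree_derivatives_antimono by blast
  obtain s w where s: "s \<in> T" "prefix t s" "weights s 1 w" and w: "\<forall>F\<in>Sch \<alpha>. sum w F \<le> \<epsilon>"
    using small_averagesD[OF small[OF \<alpha>] T t' \<epsilon>] by (elim bexE exE conjE)
  have "sum w F \<le> \<epsilon>" if F: "F \<in> Sch \<delta>" and x: "x \<in> F" "x \<le> p" for F x
  proof -
    obtain n where n: "1 \<le> n" "F \<in> Sch (osuc (\<sigma> \<delta> n))" "\<And>x. x \<in> F \<Longrightarrow> n \<le> x"
      using Sch_limitD[OF \<delta> F] x(1) by blast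
    have "n \<le> max 1 p" using n(3)[OF x(1)] x(2) by simp
    then have "F \<in> Sch \<alpha>"
      using Sch_choice_mono[OF \<delta> n(1)] n(2) unfolding \<alpha>_def by blast
    then show ?thesis using w by blast
  qed
  then show "\<exists>s\<in>T. \<exists>w. prefix t s \<and> weights s 1 w \<and> (\<forall>F\<in>Sch \<delta>. (\<exists>x\<in>F. x \<le> p) \<longrightarrow> sum w F \<le> \<epsilon>)"
    using s by blast
qed

text \<open>
  The lemmas \<open>late_averages_osuc\<close> and \<open>late_averages_limit\<close> turn averages for smaller indices into
  averages against sets with a bounded starting point, and stacking blocks removes the bound at the cost of one further factor \<open>\<omega>\<close> in the rank.
\<close>

theorem small_averages_Sch:
  "\<alpha> < omega1 \<Longrightarrow> small_averages (Sch \<alpha>) (omega_pow (osuc \<alpha>))"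
proof (induction \<alpha> rule: ordinal_induct)
  case zero
  show ?case by (simp add: schreier_zero small_averages_schreier0)
next
  case (osuc \<alpha>)
  then have \<alpha>: "\<alpha> < omega1" using osuc_less_omega1D by blast
  show ?case
    using regular_finite[OF regular_Sch[OF osuc.prems]] late_averages_osuc[OF \<alpha> osuc.IH[OF \<alpha>]]
    by (intro small_averagesI) simp_all
next
  case (limit \<delta>)
  have "small_averages (Sch \<alpha>) (omega_pow (osuc \<alpha>))" if "\<alpha> < \<delta>" for \<alpha>
    using limit(2)[OF that] that limit(3) less_trans by blast
  then have "late_averages (Sch \<delta>) (omega_pow \<delta>)"
    by (rule late_averages_limit[OF limit(1,3)])
  then show ?case
    using regular_finite[OF regular_Sch[OF limit(3)]] by (intro small_averagesI) simp_all
qed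

end

section \<open>The Tsirelson norm\<close>

abbreviation supp :: "(nat \<Rightarrow> 'k::zero) \<Rightarrow> nat set"
  where "supp x \<equiv> {i. x i \<noteq> 0}"

definition l1_norm :: "(nat \<Rightarrow> 'k::real_normed_field) \<Rightarrow> real"
  where "l1_norm x = (\<Sum>i\<in>supp x. norm (x i))"

lemma c00_finite: "x \<in> c00 \<Longrightarrow> finite (supp x)"
  by (simp add: c00_def)

lemma l1_norm_eq: "finite S \<Longrightarrow> supp x \<subseteq> S \<Longrightarrow> l1_norm x = (\<Sum>i\<in>S. norm (x i))"
  unfolding l1_norm_def by (rule sum.mono_neutral_left) auto

lemma restr_c00: "x \<in> c00 \<Longrightarrow> restr E x \<in> c00"
  unfolding c00_def restr_def by (auto elim: rev_finite_subset)

lemma restr_restr: "restr E (restr E' x) = restr E' (restr E x)"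
  by (auto simp: restr_def)

lemma l1_norm_nonneg: "0 \<le> l1_norm x"
  by (simp add: l1_norm_def sum_nonneg)

lemma norm_le_l1_norm: "x \<in> c00 \<Longrightarrow> norm (x i) \<le> l1_norm x"
  by (cases "x i = 0") (auto simp: l1_norm_def c00_finite sum_nonneg intro!: member_le_sum)

lemma bdd_above_norms: "x \<in> c00 \<Longrightarrow> bdd_above (range (\<lambda>i. norm (x i)))"
  using norm_le_l1_norm by (intro bdd_aboveI2) auto

lemma l1_norm_admissible:
  assumes x: "x \<in> c00" and Es: "admissible A Es"
  shows "(\<Sum>E\<in>set Es. l1_norm (restr E x)) \<le> l1_norm x"
proof -
  have "l1_norm (restr E x) = (\<Sum>i\<in>E. norm (restr E x i))" if "E \<in> set Es" for E
    using admissible_finite[OF Es that] by (intro l1_norm_eq) (auto simp: restr_def)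
  moreover have "(\<Sum>i\<in>E. norm (restr E x i)) = (\<Sum>i\<in>E. norm (x i))" for E
    by (intro sum.cong) (auto simp: restr_def)
  ultimately have "(\<Sum>E\<in>set Es. l1_norm (restr E x)) = (\<Sum>E\<in>set Es. \<Sum>i\<in>E. norm (x i))"
    by simp
  also have "\<dots> = (\<Sum>i\<in>\<Union>(set Es). norm (x i))"
    by (rule admissible_sum_Union[OF Es, symmetric])
  also have "\<dots> = (\<Sum>i\<in>\<Union>(set Es) \<inter> supp x. norm (x i))"
    using admissible_finite[OF Es] by (intro sum.mono_neutral_right) auto
  also have "\<dots> \<le> l1_norm x"
    unfolding l1_norm_def using c00_finite[OF x] by (intro sum_mono2) auto
  finally show ?thesis .
qed

locale tsirelson =
  fixes A :: "nat set set" and \<theta> :: real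
  assumes regular: "regular_family A" and \<theta>: "0 < \<theta>" "\<theta> < 1"
begin

abbreviation approx where "approx \<equiv> tsirelson_approx \<theta> A"
abbreviation N where "N \<equiv> tsirelson_norm \<theta> A"

lemma admissible_Nil: "admissible A []"
  using regular_empty[OF regular] by (simp add: admissible_def)

lemma coordinate_le_approx: "x \<in> c00 \<Longrightarrow> norm (x i) \<le> approx 0 x"
  using cSUP_upper[OF UNIV_I bdd_above_norms[of x], of i] by simp

lemma approx_bounds:
  fixes x :: "nat \<Rightarrow> 'k::real_normed_field"
  shows "x \<in> c00 \<Longrightarrow> 0 \<le> approx n x \<and> approx n x \<le> l1_norm x"
proof (induction n arbitrary: x)
  case 0
  have "norm (x 0) \<le> approx 0 x"
    by (rule coordinate_le_approx[OF 0])
  moreover have "approx 0 x \<le> l1_norm x"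
    using norm_le_l1_norm[OF 0] by (simp add: cSUP_least)
  ultimately show ?case by (meson norm_ge_zero order_trans)
next
  case (Suc n)
  have "\<theta> * (\<Sum>E\<leftarrow>Es. approx n (restr E x)) \<le> l1_norm x" if Es: "admissible A Es" for Es
  proof -
    have "(\<Sum>E\<leftarrow>Es. approx n (restr E x)) \<le> (\<Sum>E\<in>set Es. l1_norm (restr E x))"
      unfolding admissible_sum_list[OF Es] using Suc by (intro sum_mono) (auto simp: restr_c00)
    also have "\<dots> \<le> l1_norm x" by (rule l1_norm_admissible[OF Suc.prems Es])
    finally have "\<theta> * (\<Sum>E\<leftarrow>Es. approx n (restr E x)) \<le> 1 * l1_norm x"
      using \<theta> l1_norm_nonneg[of x] by (intro mult_mono') (auto simp: admissible_sum_list[OF Es]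
          intro!: sum_nonneg Suc.IH[THEN conjunct1] restr_c00 Suc.prems)
    then show ?thesis by simp
  qed
  then have "(SUP Es\<in>{Es. admissible A Es}. \<theta> * (\<Sum>E\<leftarrow>Es. approx n (restr E x))) \<le> l1_norm x"
    using admissible_Nil by (intro cSUP_least) auto
  with Suc show ?case by (auto simp: le_max_iff_disj)
qed

lemma approx_admissible:
  fixes x :: "nat \<Rightarrow> 'k::real_normed_field"
  assumes x: "x \<in> c00" and Es: "admissible A Es"
  shows "\<theta> * (\<Sum>E\<in>set Es. approx n (restr E x)) \<le> approx (Suc n) x"
proof -
  have "\<theta> * (\<Sum>E\<leftarrow>Es'. approx n (restr E x)) \<le> \<theta> * l1_norm x" if Es': "admissible A Es'" for Es'
  proof -
    have "(\<Sum>E\<leftarrow>Es'. approx n (restr E x)) \<le> (\<Sum>E\<in>set Es'. l1_norm (restr E x))"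
      unfolding admissible_sum_list[OF Es'] using approx_bounds restr_c00[OF x] by (intro sum_mono) blast
    also have "\<dots> \<le> l1_norm x" by (rule l1_norm_admissible[OF x Es'])
    finally show ?thesis using \<theta> by simp
  qed
  then have bdd: "bdd_above ((\<lambda>Es. \<theta> * (\<Sum>E\<leftarrow>Es. approx n (restr E x))) ` {Es. admissible A Es})"
    by (intro bdd_aboveI2) auto
  have "\<theta> * (\<Sum>E\<leftarrow>Es. approx n (restr E x)) \<le>
      (SUP Es\<in>{Es. admissible A Es}. \<theta> * (\<Sum>E\<leftarrow>Es. approx n (restr E x)))"
    by (rule cSUP_upper[OF _ bdd]) (use Es in simp)
  then show ?thesis
    by (simp add: admissible_sum_list[OF Es] le_max_iff_disj)
qed

lemma
  assumes x: "x \<in> c00"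
  shows approx_tendsto: "(\<lambda>n. approx n x) \<longlonglongrightarrow> N x" and approx_le_norm: "approx n x \<le> N x"
proof -
  have inc: "incseq (\<lambda>n. approx n x)" by (rule incseq_SucI) simp
  moreover have "Bseq (\<lambda>n. approx n x)"
    using approx_bounds[OF x] by (intro BseqI'[of _ "l1_norm x"]) simp
  ultimately have "convergent (\<lambda>n. approx n x)"
    by (intro Bseq_monoseq_convergent incseq_imp_monoseq)
  then show *: "(\<lambda>n. approx n x) \<longlonglongrightarrow> N x"
    unfolding tsirelson_norm_def by (simp add: convergent_LIMSEQ_iff)
  show "approx n x \<le> N x" using inc * by (rule incseq_le)
qed

lemma norm_leI: "x \<in> c00 \<Longrightarrow> (\<And>n. approx n x \<le> B) \<Longrightarrow> N x \<le> B"
  by (rule LIMSEQ_le_const2[OF approx_tendsto]) auto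

lemma norm_nonneg: "x \<in> c00 \<Longrightarrow> 0 \<le> N x"
  using approx_bounds approx_le_norm order_trans by blast

lemma norm_le_l1: "x \<in> c00 \<Longrightarrow> N x \<le> l1_norm x"
  using approx_bounds by (intro norm_leI) auto

lemma coordinate_le_norm:
  assumes x: "x \<in> c00" shows "norm (x i) \<le> N x"
proof -
  have "norm (x i) \<le> approx 0 x" by (rule coordinate_le_approx[OF x])
  also have "\<dots> \<le> N x" by (rule approx_le_norm[OF x])
  finally show ?thesis .
qed

lemma norm_admissible:
  assumes x: "x \<in> c00" and Es: "admissible A Es"
  shows "\<theta> * (\<Sum>E\<in>set Es. N (restr E x)) \<le> N x"
proof (rule LIMSEQ_le_const2)
  show "(\<lambda>n. \<theta> * (\<Sum>E\<in>set Es. approx n (restr E x))) \<longlonglongrightarrow> \<theta> * (\<Sum>E\<in>set Es. N (restr E x))"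
    using restr_c00[OF x] by (intro tendsto_intros approx_tendsto)
  show "\<exists>n0. \<forall>n\<ge>n0. \<theta> * (\<Sum>E\<in>set Es. approx n (restr E x)) \<le> N x"
    using approx_admissible[OF x Es] approx_le_norm[OF x] order_trans by blast
qed

text \<open>
  Together with the two preceding lemmas this says that the limit norm satisfies the implicit
  equation which the approximations iterate.
\<close>

lemma norm_le_implicit:
  assumes x: "x \<in> c00" and "\<And>i. norm (x i) \<le> B"
    and Es: "\<And>Es. admissible A Es \<Longrightarrow> \<theta> * (\<Sum>E\<in>set Es. N (restr E x)) \<le> B"
  shows "N x \<le> B"
proof (rule norm_leI[OF x])
  show "approx n x \<le> B" for n
  proof (induction n)
    case 0
    show ?case using assms(2) by (simp add: cSUP_least)
  next
    case (Suc n)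
    have "\<theta> * (\<Sum>E\<leftarrow>Es. approx n (restr E x)) \<le> B" if "admissible A Es" for Es
    proof -
      have "(\<Sum>E\<leftarrow>Es. approx n (restr E x)) \<le> (\<Sum>E\<in>set Es. N (restr E x))"
        unfolding admissible_sum_list[OF that]
        by (intro sum_mono approx_le_norm restr_c00 x)
      then have "\<theta> * (\<Sum>E\<leftarrow>Es. approx n (restr E x)) \<le> \<theta> * (\<Sum>E\<in>set Es. N (restr E x))"
        using \<theta> by simp
      then show ?thesis using Es[OF that] by linarith
    qed
    then have "(SUP Es\<in>{Es. admissible A Es}. \<theta> * (\<Sum>E\<leftarrow>Es. approx n (restr E x))) \<le> B"
      using admissible_Nil by (intro cSUP_least) auto
    with Suc show ?case by simp
  qed
qed

lemma approx_restr:
  fixes x :: "nat \<Rightarrow> 'k::real_normed_field"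
  shows "x \<in> c00 \<Longrightarrow> approx n (restr E x) \<le> approx n x"
proof (induction n arbitrary: x)
  case 0
  have "norm (restr E x i) \<le> approx 0 x" for i
    using approx_bounds[OF 0, of 0] coordinate_le_approx[OF 0, of i]
    by (simp add: restr_def del: tsirelson_approx.simps)
  then show ?case unfolding tsirelson_approx.simps(1)[of _ _ "restr E x"] by (intro cSUP_least) auto
next
  case (Suc n)
  have "\<theta> * (\<Sum>D\<leftarrow>Es. approx n (restr D (restr E x))) \<le> approx (Suc n) x" if Es: "admissible A Es" for Es
  proof -
    have "(\<Sum>D\<leftarrow>Es. approx n (restr D (restr E x))) \<le> (\<Sum>D\<in>set Es. approx n (restr D x))"
      unfolding admissible_sum_list[OF Es] restr_restr[of _ E]
      by (intro sum_mono Suc.IH restr_c00 Suc.prems)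
    then have "\<theta> * (\<Sum>D\<leftarrow>Es. approx n (restr D (restr E x))) \<le> \<theta> * (\<Sum>D\<in>set Es. approx n (restr D x))"
      using \<theta> by simp
    also have "\<dots> \<le> approx (Suc n) x" by (rule approx_admissible[OF Suc.prems Es])
    finally show ?thesis .
  qed
  then have "(SUP Es\<in>{Es. admissible A Es}. \<theta> * (\<Sum>D\<leftarrow>Es. approx n (restr D (restr E x))))
      \<le> approx (Suc n) x"
    using admissible_Nil by (intro cSUP_least) auto
  moreover have "approx n (restr E x) \<le> approx (Suc n) x"
    using Suc by (simp add: le_max_iff_disj)
  ultimately show ?case
    unfolding tsirelson_approx.simps(2)[of _ _ _ "restr E x"] by (rule max.boundedI[rotated])
qed

lemma norm_restr: "x \<in> c00 \<Longrightarrow> N (restr E x) \<le> N x"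
  by (intro norm_leI restr_c00 order_trans[OF approx_restr approx_le_norm])

lemma norm_restr_disjoint:
  assumes "x \<in> c00" "E \<inter> supp x = {}" shows "N (restr E x) = 0"
proof -
  have "supp (restr E x) = {}" using assms(2) by (auto simp: restr_def)
  then have "l1_norm (restr E x) = 0" by (simp add: l1_norm_def)
  then show ?thesis
    using norm_le_l1 norm_nonneg restr_c00[OF assms(1)] by (metis antisym)
qed

text \<open>
  Each level of the bracket splits the support into an admissible family and costs one factor \<open>\<theta>\<close>.
\<close>

lemma iterated_bracket_lower_bound:
  "F \<in> (bracket A ^^ n) schreier0 \<Longrightarrow> x \<in> c00 \<Longrightarrow> \<theta> ^ n * (\<Sum>i\<in>F. norm (x i)) \<le> N x"
proof (induction n arbitrary: F x)
  case 0
  then have "finite F" "card F \<le> 1" by (auto simp: schreier0_def fin_pos_def)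
  then consider "F = {}" | i where "F = {i}"
    by (metis card_0_eq card_1_singletonE le_neq_implies_less less_one)
  then show ?case
    using norm_nonneg coordinate_le_norm 0(2) by cases auto
next
  case (Suc n)
  show ?case
  proof (cases "F = {}")
    case True
    then show ?thesis using norm_nonneg Suc.prems by simp
  next
    case False
    then obtain Es where Es: "F = \<Union>(set Es)" "admissible A Es"
      "set Es \<subseteq> (bracket A ^^ n) schreier0"
      using Suc.prems(1) by (auto elim: bracketE)
    have "\<theta> ^ n * (\<Sum>i\<in>E. norm (x i)) \<le> N (restr E x)" if "E \<in> set Es" for E
    proof -
      have "(\<Sum>i\<in>E. norm (x i)) = (\<Sum>i\<in>E. norm (restr E x i))"
        by (intro sum.cong) (auto simp: restr_def)
      then show ?thesis
        using Suc.IH[of E "restr E x"] Es(3) that restr_c00[OF Suc.prems(2)] by auto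
    qed
    then have "(\<Sum>E\<in>set Es. \<theta> ^ n * (\<Sum>i\<in>E. norm (x i))) \<le> (\<Sum>E\<in>set Es. N (restr E x))"
      by (rule sum_mono)
    then have "\<theta> * (\<Sum>E\<in>set Es. \<theta> ^ n * (\<Sum>i\<in>E. norm (x i))) \<le> \<theta> * (\<Sum>E\<in>set Es. N (restr E x))"
      using \<theta> by simp
    also have "\<dots> \<le> N x" by (rule norm_admissible[OF Suc.prems(2) Es(2)])
    also have "\<theta> * (\<Sum>E\<in>set Es. \<theta> ^ n * (\<Sum>i\<in>E. norm (x i))) = \<theta> ^ Suc n * (\<Sum>i\<in>F. norm (x i))"
      unfolding Es(1) admissible_sum_Union[OF Es(2)] by (simp add: sum_distrib_left mult.assoc)
    finally show ?thesis .
  qed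
qed

end

section \<open>Tsirelson spaces\<close>

definition unit_seq :: "nat \<Rightarrow> nat \<Rightarrow> 'k::real_normed_field"
  where "unit_seq n i = (if i = n then 1 else 0)"

lemma unit_seq_c00: "1 \<le> n \<Longrightarrow> unit_seq n \<in> c00"
  by (auto simp: unit_seq_def c00_def)

lemma l1_norm_unit_seq: "l1_norm (unit_seq n :: nat \<Rightarrow> 'k::real_normed_field) = 1"
proof -
  have "supp (unit_seq n :: nat \<Rightarrow> 'k) = {n}" by (auto simp: unit_seq_def)
  then show ?thesis by (simp add: l1_norm_def unit_seq_def)
qed

lemma canonical_basis_unit_seq: "canonical_basis \<iota> n = \<iota> (unit_seq n)"
  by (simp add: canonical_basis_def unit_seq_def[abs_def])

lemma zero_c00: "(\<lambda>i. 0) \<in> c00"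
  by (simp add: c00_def)

lemma sum_c00:
  assumes "finite I" "\<And>i. i \<in> I \<Longrightarrow> u i \<in> c00"
  shows "(\<lambda>k. \<Sum>i\<in>I. c i * u i k) \<in> c00"
proof -
  have "supp (\<lambda>k. \<Sum>i\<in>I. c i * u i k) \<subseteq> (\<Union>i\<in>I. supp (u i))"
  proof
    fix k assume "k \<in> supp (\<lambda>k. \<Sum>i\<in>I. c i * u i k)"
    then have "(\<Sum>i\<in>I. c i * u i k) \<noteq> 0" by simp
    then obtain i where "i \<in> I" "c i * u i k \<noteq> 0" by (rule sum.not_neutral_contains_not_neutral)
    then show "k \<in> (\<Union>i\<in>I. supp (u i))" by auto
  qed
  moreover have "finite (\<Union>i\<in>I. supp (u i))" using assms by (auto simp: c00_def)
  ultimately show ?thesis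
    using assms(2) by (auto simp: c00_def intro: finite_subset)
qed

locale tsirelson_space = tsirelson A \<theta> for A \<theta> +
  fixes smul :: "'k::real_normed_field \<Rightarrow> 'x::real_normed_vector \<Rightarrow> 'x"
    and \<iota> :: "(nat \<Rightarrow> 'k) \<Rightarrow> 'x" and X :: "'x set"
  assumes completion: "completion_of_c00 smul (tsirelson_norm \<theta> A) \<iota> X"
begin

lemma banach: "banach_space smul X"
  using completion by (simp add: completion_of_c00_def)

sublocale vector_space smul
  using banach by (simp add: banach_space_def normed_scaling_def)

lemma norm_smul: "norm (smul c x) = norm c * norm x"
  using banach by (simp add: banach_space_def normed_scaling_def)

lemma norm_\<iota>: "x \<in> c00 \<Longrightarrow> norm (\<iota> x) = N x"
  and \<iota>_X: "x \<in> c00 \<Longrightarrow> \<iota> x \<in> X"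
  and \<iota>_add: "x \<in> c00 \<Longrightarrow> y \<in> c00 \<Longrightarrow> \<iota> (\<lambda>i. x i + y i) = \<iota> x + \<iota> y"
  and \<iota>_mult: "x \<in> c00 \<Longrightarrow> \<iota> (\<lambda>i. c * x i) = smul c (\<iota> x)"
  using completion by (auto simp: completion_of_c00_def)

lemma \<iota>_zero: "\<iota> (\<lambda>i. 0) = 0"
  using \<iota>_mult[OF zero_c00, of 0] by simp

lemma \<iota>_sum:
  fixes c :: "'i \<Rightarrow> 'k"
  assumes "finite I" "\<And>i. i \<in> I \<Longrightarrow> u i \<in> c00"
  shows "\<iota> (\<lambda>k. \<Sum>i\<in>I. c i * u i k) = (\<Sum>i\<in>I. smul (c i) (\<iota> (u i)))"
  using assms
proof (induction I rule: finite_induct)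
  case (insert j I)
  have "(\<lambda>k. c j * u j k) \<in> c00"
    using sum_c00[of "{j}" u c] insert.prems by simp
  moreover have "(\<lambda>k. \<Sum>i\<in>I. c i * u i k) \<in> c00"
    using insert by (intro sum_c00) auto
  ultimately show ?case
    using insert by (simp add: \<iota>_add \<iota>_mult)
qed (simp add: \<iota>_zero)

lemma norm_sum_le:
  fixes c :: "'i \<Rightarrow> 'k"
  assumes "finite I" "\<And>i. i \<in> I \<Longrightarrow> u i \<in> c00"
  shows "N (\<lambda>k. \<Sum>i\<in>I. c i * u i k) \<le> (\<Sum>i\<in>I. norm (c i) * N (u i))"
proof -
  have "N (\<lambda>k. \<Sum>i\<in>I. c i * u i k) = norm (\<Sum>i\<in>I. smul (c i) (\<iota> (u i)))"
    using assms by (simp add: \<iota>_sum sum_c00 flip: norm_\<iota>)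
  also have "\<dots> \<le> (\<Sum>i\<in>I. norm (c i) * N (u i))"
    using assms by (intro sum_norm_le) (simp add: norm_smul norm_\<iota>)
  finally show ?thesis .
qed

lemma norm_unit_seq: "1 \<le> n \<Longrightarrow> N (unit_seq n :: nat \<Rightarrow> 'k) \<le> 1"
  using norm_le_l1[OF unit_seq_c00[of n]] by (simp add: l1_norm_unit_seq)

text \<open>
  Along \<open>\<phi>\<close> the supports of combinations indexed by a set of the family become members of the \<open>n\<close>-fold
  bracket, where the lower estimate holds; the upper estimate is the triangle inequality.
\<close>

lemma basis_l1_spreading_model:
  fixes \<phi> :: "nat \<Rightarrow> nat"
  assumes \<phi>: "strict_mono \<phi>" "\<And>F. F \<in> schreier \<sigma> \<eta> \<Longrightarrow> \<phi> ` F \<in> (bracket A ^^ n) schreier0"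
    and fp: "schreier \<sigma> \<eta> \<subseteq> fin_pos"
  shows "l1_spreading_model smul \<sigma> X (1 / \<theta> ^ n) \<eta> (\<lambda>i. canonical_basis \<iota> (\<phi> i))"
  unfolding l1_spreading_model_def
proof (intro conjI allI ballI impI)
  have pos: "1 \<le> \<phi> i" if "1 \<le> i" for i
    using strict_mono_imp_increasing[OF \<phi>(1), of i] that by simp
  show inX: "canonical_basis \<iota> (\<phi> i) \<in> X" if "1 \<le> i" for i
    using pos[OF that] by (simp add: canonical_basis_unit_seq \<iota>_X unit_seq_c00)
  fix F assume F: "F \<in> schreier \<sigma> \<eta>"
  define L where "L = sorted_list_of_set F"
  have fin: "finite F" "0 \<notin> F" using F fp by (auto simp: fin_pos_def)
  have L: "set L = F" "distinct L" using fin by (simp_all add: L_def)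
  have F1: "1 \<le> i" if "i \<in> F" for i using fin(2) that by (cases i) auto
  let ?xs = "map (\<lambda>i. canonical_basis \<iota> (\<phi> i)) L"
  let ?e = "\<lambda>i. unit_seq (\<phi> (L ! i)) :: nat \<Rightarrow> 'k"
  have e: "?e i \<in> c00" "N (?e i) \<le> 1" if "i < length L" for i
    using pos[OF F1] L(1) nth_mem[OF that] by (auto simp: unit_seq_c00 norm_unit_seq)
  have xs: "?xs ! i = \<iota> (?e i)" if "i < length L" for i
    using that by (simp add: canonical_basis_unit_seq)
  have inj: "inj_on (\<lambda>i. \<phi> (L ! i)) {..<length L}"
    using L(2) strict_mono_eq[OF \<phi>(1)] by (auto simp: inj_on_def nth_eq_iff_index_eq)
  have img: "(\<lambda>i. \<phi> (L ! i)) ` {..<length L} = \<phi> ` F"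
    unfolding L(1)[symmetric] by (auto simp: set_conv_nth)
  have "1 / (1 / \<theta> ^ n) \<le> norm (\<Sum>i<length ?xs. smul (a i) (?xs ! i)) \<and>
      norm (\<Sum>i<length ?xs. smul (a i) (?xs ! i)) \<le> 1"
    if a: "(\<Sum>i<length ?xs. norm (a i)) = 1" for a :: "nat \<Rightarrow> 'k"
  proof -
    define u where "u k = (\<Sum>i<length L. a i * ?e i k)" for k
    have u: "u \<in> c00" unfolding u_def[abs_def] using e(1) by (intro sum_c00) auto
    have norm_u: "norm (\<Sum>i<length ?xs. smul (a i) (?xs ! i)) = N u"
      using e(1) xs u \<iota>_sum[of "{..<length L}" ?e a] by (simp add: u_def[abs_def] flip: norm_\<iota>)
    have "u (\<phi> (L ! j)) = a j" if "j < length L" for j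
    proof -
      have "u (\<phi> (L ! j)) = (\<Sum>i<length L. if i = j then a i else 0)"
        unfolding u_def using that inj by (intro sum.cong) (auto simp: unit_seq_def inj_on_def)
      then show ?thesis using that by simp
    qed
    then have "(\<Sum>k\<in>\<phi> ` F. norm (u k)) = 1"
      unfolding img[symmetric] using a by (simp add: sum.reindex[OF inj])
    then have "\<theta> ^ n \<le> N u"
      using iterated_bracket_lower_bound[OF \<phi>(2)[OF F] u] by simp
    moreover have "N u \<le> (\<Sum>i<length L. norm (a i) * N (?e i))"
      unfolding u_def[abs_def] using e(1) by (intro norm_sum_le) auto
    moreover have "\<dots> \<le> (\<Sum>i<length L. norm (a i) * 1)"
      using e(2) by (intro sum_mono mult_left_mono) auto
    ultimately show ?thesis using a norm_u by simp
  qed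
  moreover have "set ?xs \<subseteq> X" using inX F1 L(1) by auto
  moreover have "\<forall>x\<in>set ?xs. norm x \<le> 1"
    using pos F1 L(1) by (auto simp: canonical_basis_unit_seq norm_\<iota> unit_seq_c00 norm_unit_seq)
  ultimately show "map (\<lambda>i. canonical_basis \<iota> (\<phi> i)) (sorted_list_of_set F)
      \<in> l1_tree smul X (1 / \<theta> ^ n)"
    unfolding l1_tree_def L_def by blast
qed

text \<open>
  A vector with finite support with respect to the basis is a finite combination of basis vectors, so it
  comes from a finitely supported sequence with the same support.  This transfers block sequences of the
  abstract completion to sequences of scalars.
\<close>

lemma block_vector:
  assumes fdd: "fdd smul (basis_fdd smul (canonical_basis \<iota>)) X" and x: "x \<in> X"
    and fin: "finite (fdd_supp (basis_fdd smul (canonical_basis \<iota>)) x)"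
  obtains u where "u \<in> c00" "\<iota> u = x" "supp u = fdd_supp (basis_fdd smul (canonical_basis \<iota>)) x"
proof -
  let ?E = "basis_fdd smul (canonical_basis \<iota>)"
  define y where "y = (THE y. (\<forall>n. y n \<in> ?E n) \<and> y sums x)"
  have "\<forall>x\<in>X. \<exists>!y. (\<forall>n. y n \<in> ?E n) \<and> y sums x"
    using fdd unfolding fdd_def by (elim conjE)
  from theI'[OF bspec[OF this x]] have y: "\<And>n. y n \<in> ?E n" "y sums x" unfolding y_def by blast+
  define S where "S = {n. y n \<noteq> 0}"
  have S: "S = fdd_supp ?E x" by (simp add: S_def fdd_supp_def y_def)
  have finS: "finite S" using fin S by simp
  have pos: "1 \<le> n" if "n \<in> S" for n
    using y(1)[of 0] that by (cases n) (auto simp: basis_fdd_def S_def)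
  have "\<exists>c. y n = smul c (canonical_basis \<iota> n)" if "n \<in> S" for n
    using y(1)[of n] pos[OF that] by (auto simp: basis_fdd_def)
  then obtain c where c: "\<And>n. n \<in> S \<Longrightarrow> y n = smul (c n) (canonical_basis \<iota> n)" by metis
  define u where "u k = (\<Sum>n\<in>S. c n * unit_seq n k)" for k
  have u_eq: "u k = (if k \<in> S then c k else 0)" for k
  proof -
    have "u k = (\<Sum>n\<in>S. if n = k then c n else 0)"
      unfolding u_def by (intro sum.cong) (auto simp: unit_seq_def)
    then show ?thesis using finS by simp
  qed
  have "c n \<noteq> 0" if "n \<in> S" for n
    using that c[OF that] by (auto simp: S_def)
  then have "supp u = S" using u_eq by auto
  moreover have "u \<in> c00"
    unfolding u_def[abs_def] using finS pos by (intro sum_c00 unit_seq_c00)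
  moreover have "\<iota> u = x"
  proof -
    have "\<iota> u = (\<Sum>n\<in>S. y n)"
      unfolding u_def[abs_def] using finS pos c
      by (subst \<iota>_sum) (auto simp: unit_seq_c00 canonical_basis_unit_seq)
    moreover have "y sums (\<Sum>n\<in>S. y n)"
      using finS by (intro sums_finite) (auto simp: S_def)
    ultimately show ?thesis using y(2) sums_unique2 by metis
  qed
  ultimately show ?thesis using that S by blast
qed

text \<open>
  The norm is controlled through its implicit equation.  For an admissible family \<open>Es\<close>, let \<open>D\<close> be the set of
  the \<open>i\<close> for which two members of \<open>Es\<close> meet the support of \<open>u i\<close>.  For \<open>i\<close> outside \<open>D\<close> the restrictions
  contribute at most \<open>\<theta>\<close> times the norm of \<open>u i\<close>; for \<open>i\<close> in \<open>D\<close> they contribute at most the norm of \<open>u i\<close>, but \<open>m ` D\<close>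
  belongs to the family \<open>A\<close> and so carries weight at most \<open>\<delta>\<close>.
\<close>

lemma block_norm_upper_bound:
  fixes u :: "nat \<Rightarrow> nat \<Rightarrow> 'k" and a :: "nat \<Rightarrow> 'k"
  defines "m \<equiv> \<lambda>i. Max (supp (u i))"
  assumes u: "\<And>i. i < n \<Longrightarrow> u i \<in> c00" "\<And>i. i < n \<Longrightarrow> N (u i) \<le> 1" "\<And>i. i < n \<Longrightarrow> supp (u i) \<noteq> {}"
    and succ: "\<And>i j. i < j \<Longrightarrow> j < n \<Longrightarrow> set_less (supp (u i)) (supp (u j))"
    and \<delta>: "\<And>F. F \<in> A \<Longrightarrow> (\<Sum>i\<in>{i. i < n \<and> m i \<in> F}. norm (a i)) \<le> \<delta>"
  shows "N (\<lambda>k. \<Sum>i<n. a i * u i k) \<le> \<delta> + \<theta> * (\<Sum>i<n. norm (a i))"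
proof -
  define x where "x k = (\<Sum>i<n. a i * u i k)" for k
  have x: "x \<in> c00" unfolding x_def[abs_def] using u by (intro sum_c00) auto
  have m: "m i \<in> supp (u i)" "\<And>k. k \<in> supp (u i) \<Longrightarrow> k \<le> m i" if "i < n" for i
    using c00_finite[OF u(1)[OF that]] u(3)[OF that] unfolding m_def
    by (auto simp del: mem_Collect_eq intro: Max_in Max_ge)
  have \<delta>0: "0 \<le> \<delta>" using \<delta>[OF regular_empty[OF regular]] by simp
  have S0: "0 \<le> \<theta> * (\<Sum>i<n. norm (a i))" using \<theta> by (simp add: sum_nonneg)
  have "norm (x k) \<le> \<delta>" for k
  proof (cases "\<exists>i<n. u i k \<noteq> 0")
    case False
    then show ?thesis using \<delta>0 by (simp add: x_def)
  next
    case True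
    then obtain i where i: "i < n" "u i k \<noteq> 0" by blast
    have "u j k = 0" if "j < n" "j \<noteq> i" for j
    proof (rule ccontr)
      assume "u j k \<noteq> 0"
      then have k: "k \<in> supp (u i)" "k \<in> supp (u j)" using i by simp_all
      from that(2) have "i < j \<or> j < i" by linarith
      then have "k < k"
      proof
        assume "i < j"
        from succ[OF this that(1)] k show ?thesis by blast
      next
        assume "j < i"
        from succ[OF this i(1)] k show ?thesis by blast
      qed
      then show False by simp
    qed
    then have "x k = (\<Sum>j<n. if j = i then a i * u i k else 0)"
      unfolding x_def by (intro sum.cong) auto
    then have "norm (x k) = norm (a i) * norm (u i k)"
      using i by (simp add: norm_mult)
    also have "\<dots> \<le> norm (a i) * 1"
      using coordinate_le_norm[OF u(1)[OF i(1)], of k] u(2)[OF i(1)] by (intro mult_left_mono) auto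
    also have "\<dots> \<le> (\<Sum>j\<in>{j. j < n \<and> m j \<in> {m i}}. norm (a j))"
      using i(1) by (simp, intro member_le_sum) auto
    also have "\<dots> \<le> \<delta>"
    proof (rule \<delta>, rule regular_singleton[OF regular])
      have "u i 0 = 0" using u(1)[OF i(1)] by (simp add: c00_def)
      then show "1 \<le> m i" using m(1)[OF i(1)] by (cases "m i") auto
    qed
    finally show ?thesis .
  qed
  then have coord: "norm (x k) \<le> \<delta> + \<theta> * (\<Sum>i<n. norm (a i))" for k
    using S0 by (meson add_increasing2 order_trans order_refl)
  have "\<theta> * (\<Sum>E\<in>set Es. N (restr E x)) \<le> \<delta> + \<theta> * (\<Sum>i<n. norm (a i))" if Es: "admissible A Es" for Es
  proof -
    define D where "D = {i. i < n \<and> (\<exists>E\<in>set Es. \<exists>E'\<in>set Es. set_less E E' \<and>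
      E \<inter> supp (u i) \<noteq> {} \<and> E' \<inter> supp (u i) \<noteq> {})}"
    define C where "C i = \<theta> * (\<Sum>E\<in>set Es. N (restr E (u i)))" for i
    have C1: "C i \<le> 1" if "i < n" for i
      unfolding C_def using norm_admissible[OF u(1)[OF that] Es] u(2)[OF that] by linarith
    have C2: "C i \<le> \<theta>" if i: "i < n" "i \<notin> D" for i
    proof (cases "\<exists>E\<in>set Es. E \<inter> supp (u i) \<noteq> {}")
      case False
      then show ?thesis
        using \<theta> norm_restr_disjoint[OF u(1)[OF i(1)]] by (simp add: C_def)
    next
      case True
      then obtain E where E: "E \<in> set Es" "E \<inter> supp (u i) \<noteq> {}" by blast
      have "N (restr E' (u i)) = 0" if E': "E' \<in> set Es" "E' \<noteq> E" for E'
      proof (rule norm_restr_disjoint[OF u(1)[OF i(1)]], rule ccontr)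
        assume "E' \<inter> supp (u i) \<noteq> {}"
        then show False
          using i E E' admissible_comparable[OF Es E(1) E'(1)] unfolding D_def by blast
      qed
      then have "(\<Sum>E\<in>set Es. N (restr E (u i))) = (\<Sum>E'\<in>set Es. if E' = E then N (restr E (u i)) else 0)"
        by (intro sum.cong) auto
      also have "\<dots> = N (restr E (u i))" using E(1) by simp
      also have "\<dots> \<le> 1"
        using norm_restr[OF u(1)[OF i(1)], of E] u(2)[OF i(1)] by linarith
      finally have "\<theta> * (\<Sum>E\<in>set Es. N (restr E (u i))) \<le> \<theta> * 1"
        using \<theta> by (intro mult_left_mono) auto
      then show ?thesis by (simp add: C_def)
    qed
    \<comment> \<open>Of two members meeting the support of \<open>u i\<close>, the later one has its minimum in the range of \<open>u i\<close>.\<close>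
    have "\<exists>k\<in>Min ` set Es. (\<exists>l\<in>supp (u i). l \<le> k) \<and> k \<le> m i" if "i \<in> D" for i
    proof -
      obtain E E' k l where E: "E \<in> set Es" "E' \<in> set Es" "set_less E E'" "k \<in> E" "k \<in> supp (u i)"
        "l \<in> E'" "l \<in> supp (u i)" "i < n"
        using \<open>i \<in> D\<close> unfolding D_def by blast
      have "finite E'" "E' \<noteq> {}" using admissible_finite[OF Es E(2)] by auto
      then have "Min E' \<in> E'" "Min E' \<le> l" using E(6) by (auto intro: Min_in)
      then show ?thesis
        using E m(2)[OF E(8,7)] by (intro bexI[of _ "Min E'"]) (auto intro: less_imp_le bexI[of _ k])
    qed
    then obtain g where g: "\<And>i. i \<in> D \<Longrightarrow> g i \<in> Min ` set Es" "\<And>i. i \<in> D \<Longrightarrow> \<exists>l\<in>supp (u i). l \<le> g i"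
      "\<And>i. i \<in> D \<Longrightarrow> g i \<le> m i"
      by metis
    have m_less: "m i < l" if "i < j" "j < n" "l \<in> supp (u j)" for i j l
      using succ[OF that(1,2)] m(1)[of i] that by (meson less_trans)
    have "Min ` set Es \<in> A" using Es unfolding admissible_def by (elim conjE)
    then have "g ` D \<in> A"
      by (rule regular_subset[OF regular]) (use g(1) in blast)
    moreover have "strict_mono_on D g"
    proof (rule strict_mono_onI)
      fix i j assume ij: "i \<in> D" "j \<in> D" "i < j"
      then obtain l where l: "l \<in> supp (u j)" "l \<le> g j" using g(2) by blast
      have "g i \<le> m i" by (rule g(3)[OF ij(1)])
      also have "m i < l" using m_less[OF ij(3) _ l(1)] ij(2) by (simp add: D_def)
      finally show "g i < g j" using l(2) by simp
    qed
    moreover have "strict_mono_on D m"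
    proof (rule strict_mono_onI)
      fix i j assume ij: "i \<in> D" "j \<in> D" "i < j"
      then have "j < n" by (simp add: D_def)
      then show "m i < m j" using m_less[OF ij(3)] m(1) by blast
    qed
    ultimately have "m ` D \<in> A"
      by (rule spreading_dominate[OF regular_spreading[OF regular]]) (rule g(3))
    from \<delta>[OF this] have \<delta>D: "(\<Sum>i\<in>D. norm (a i)) \<le> \<delta>"
    proof (rule order_trans[rotated])
      show "(\<Sum>i\<in>D. norm (a i)) \<le> (\<Sum>i\<in>{i. i < n \<and> m i \<in> m ` D}. norm (a i))"
        by (intro sum_mono2) (auto simp: D_def)
    qed
    have "(\<Sum>E\<in>set Es. N (restr E x)) \<le> (\<Sum>E\<in>set Es. \<Sum>i<n. norm (a i) * N (restr E (u i)))"
    proof (rule sum_mono)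
      fix E
      have "restr E x = (\<lambda>k. \<Sum>i<n. a i * restr E (u i) k)"
        by (auto simp: restr_def x_def)
      then show "N (restr E x) \<le> (\<Sum>i<n. norm (a i) * N (restr E (u i)))"
        using norm_sum_le[of "{..<n}" "\<lambda>i. restr E (u i)" a] restr_c00[OF u(1)] by simp
    qed
    then have "\<theta> * (\<Sum>E\<in>set Es. N (restr E x)) \<le>
        \<theta> * (\<Sum>E\<in>set Es. \<Sum>i<n. norm (a i) * N (restr E (u i)))"
      using \<theta> by simp
    also have "\<dots> = (\<Sum>i<n. norm (a i) * C i)"
      unfolding C_def by (subst sum.swap) (simp add: sum_distrib_left mult_ac)
    also have "\<dots> \<le> (\<Sum>i<n. \<theta> * norm (a i) + (if i \<in> D then norm (a i) else 0))"
    proof (rule sum_mono)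
      fix i assume "i \<in> {..<n}"
      then have i: "i < n" by simp
      show "norm (a i) * C i \<le> \<theta> * norm (a i) + (if i \<in> D then norm (a i) else 0)"
      proof (cases "i \<in> D")
        case True
        have "norm (a i) * C i \<le> norm (a i) * 1"
          using C1[OF i] by (intro mult_left_mono) auto
        then show ?thesis using True \<theta> by (simp add: add_increasing)
      next
        case False
        have "norm (a i) * C i \<le> norm (a i) * \<theta>"
          using C2[OF i False] by (intro mult_left_mono) auto
        then show ?thesis using False by (simp add: mult.commute)
      qed
    qed
    also have "\<dots> = \<theta> * (\<Sum>i<n. norm (a i)) + (\<Sum>i\<in>D. norm (a i))"
    proof -
      have "{..<n} \<inter> D = D" by (auto simp: D_def)
      then have "(\<Sum>i<n. if i \<in> D then norm (a i) else 0) = (\<Sum>i\<in>D. norm (a i))"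
        using sum.inter_restrict[of "{..<n}" "\<lambda>i. norm (a i)" D] by simp
      then show ?thesis by (simp add: sum.distrib sum_distrib_left)
    qed
    finally show ?thesis using \<delta>D by linarith
  qed
  from norm_le_implicit[OF x coord this] show ?thesis by (simp add: x_def[abs_def])
qed

end

context schreier_families
begin

text \<open>
  A single \<open>K\<close> has to be found, and \<open>1/K > \<theta>\<close> is what it takes: if the block tree had order above
  \<open>\<omega>\<^bsup>\<alpha>+1\<^esup>\<close>, the tree of the sequences of maxima of supports would have a branch carrying weights for which
  all members of \<open>Sch \<alpha>\<close> are small, and the combination of the block sequence with these weights would have
  norm less than \<open>1/K\<close>.
\<close>

lemma tsirelson_not_P2_wedge:
  fixes smul :: "'k::real_normed_field \<Rightarrow> 'x::real_normed_vector \<Rightarrow> 'x"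
  assumes \<alpha>: "\<alpha> < omega1" and "tsirelson_space (Sch \<alpha>) \<theta> smul \<iota> X"
  shows "(basis_fdd smul (canonical_basis \<iota>), X) \<notin> P2_wedge smul (osuc \<alpha>)"
proof
  interpret tsirelson_space "Sch \<alpha>" \<theta> smul \<iota> X by (rule assms(2))
  let ?E = "basis_fdd smul (canonical_basis \<iota>)"
  assume P2: "(?E, X) \<in> P2_wedge smul (osuc \<alpha>)"
  \<comment> \<open>Then \<open>1/K\<close> is the midpoint of \<open>\<theta>\<close> and \<open>1\<close>, and \<open>\<delta>\<close> below is half of its distance to \<open>\<theta>\<close>.\<close>
  define K where "K = 2 / (1 + \<theta>)"
  have "1 < K" using \<theta> by (simp add: K_def)
  with P2 have fdd: "fdd smul ?E X"
    and index: "l1_block_index smul X ?E K > Fin (omega_pow (osuc \<alpha>))"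
    by (auto simp: P2_wedge_def)
  define T where "T = l1_block_tree smul X ?E K"
  define m where "m x = Max (fdd_supp ?E x)" for x
  have vec: "\<exists>u\<in>c00. \<iota> u = x \<and> supp u = fdd_supp ?E x \<and> supp u \<noteq> {}"
    if xs: "xs \<in> T" "x \<in> set xs" for x xs
  proof -
    have x: "x \<in> X" "x \<noteq> 0" "finite (fdd_supp ?E x)"
      using xs by (auto simp: T_def l1_block_tree_def l1_tree_def block_sequence_def)
    obtain u where u: "u \<in> c00" "\<iota> u = x" "supp u = fdd_supp ?E x"
      using block_vector[OF fdd x(1,3)] by blast
    have "supp u \<noteq> {}"
    proof
      assume "supp u = {}"
      then have "u = (\<lambda>i. 0)" by auto
      with u(2) x(2) show False using \<iota>_zero by simp
    qed
    with u show ?thesis by blast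
  qed
  have admissible_supports: "sorted_wrt (\<lambda>x y. set_less (fdd_supp ?E x) (fdd_supp ?E y)) xs"
    if xs: "xs \<in> T" for xs
  proof -
    have fs: "finite (fdd_supp ?E x)" "fdd_supp ?E x \<noteq> {}" "0 \<notin> fdd_supp ?E x"
      if x: "x \<in> set xs" for x
    proof -
      obtain u where "u \<in> c00" "\<iota> u = x" "supp u = fdd_supp ?E x" "supp u \<noteq> {}"
        using vec[OF xs x] by blast
      then show "finite (fdd_supp ?E x)" "fdd_supp ?E x \<noteq> {}" "0 \<notin> fdd_supp ?E x"
        by (auto simp: c00_def)
    qed
    have "\<forall>i. Suc i < length xs \<longrightarrow> Max (fdd_supp ?E (xs ! i)) < Min (fdd_supp ?E (xs ! Suc i))"
      using xs unfolding T_def l1_block_tree_def block_sequence_def by blast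
    \<comment> \<open>Admissibility with respect to all sets: only the successiveness of all pairs is wanted.\<close>
    then have "admissible UNIV (map (fdd_supp ?E) xs)"
      using fs by (simp add: admissible_def fin_pos_def)
    then show ?thesis by (simp add: admissible_iff sorted_wrt_map)
  qed
  have m_in: "m x \<in> fdd_supp ?E x" if "xs \<in> T" "x \<in> set xs" for x xs
    using vec[OF that] c00_finite unfolding m_def by (metis Max_in)
  have sorted_m: "sorted_wrt (<) (map m xs)" if xs: "xs \<in> T" for xs
    unfolding sorted_wrt_map
    by (rule sorted_wrt_mono_rel[OF _ admissible_supports[OF xs]]) (use m_in[OF xs] in blast)
  have dist: "\<forall>s\<in>map m ` T. distinct s"
    using sorted_m strict_sorted_iff by blast
  obtain t where "t \<in> tree_derivatives (omega_pow (osuc \<alpha>)) T"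
    using tree_order_greaterD[of "omega_pow (osuc \<alpha>)" T] index unfolding l1_block_index_def T_def by blast
  moreover have "strict_prefix (map m p) (map m q)" if "strict_prefix p q" for p q
    using that by (metis list.simps(9) map_append strict_prefixE' strict_prefixI')
  ultimately have t: "map m t \<in> tree_derivatives (omega_pow (osuc \<alpha>)) (map m ` T)"
    using tree_derivatives_image[of "map m" T "map m ` T" "omega_pow (osuc \<alpha>)"] by blast
  define \<delta> where "\<delta> = (1 - \<theta>) / 4"
  have \<delta>: "0 < \<delta>" using \<theta> by (simp add: \<delta>_def)
  obtain s w where s: "s \<in> map m ` T" "weights s 1 w" and w: "\<forall>F\<in>Sch \<alpha>. sum w F \<le> \<delta>"
    using small_averagesD[OF small_averages_Sch[OF \<alpha>] dist t \<delta>] by (elim bexE exE conjE)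
  then obtain xs where xs: "xs \<in> T" "s = map m xs" by blast
  let ?n = "length xs"
  have "\<forall>i<?n. \<exists>u\<in>c00. \<iota> u = xs ! i \<and> supp u = fdd_supp ?E (xs ! i) \<and> supp u \<noteq> {}"
    using vec[OF xs(1)] by simp
  then obtain u where u: "\<And>i. i < ?n \<Longrightarrow> u i \<in> c00" "\<And>i. i < ?n \<Longrightarrow> \<iota> (u i) = xs ! i"
    "\<And>i. i < ?n \<Longrightarrow> supp (u i) = fdd_supp ?E (xs ! i)" "\<And>i. i < ?n \<Longrightarrow> supp (u i) \<noteq> {}"
    by metis
  have m_u: "Max (supp (u i)) = s ! i" if "i < ?n" for i
    using u(3)[OF that] that by (simp add: m_def xs(2))
  have inj: "inj_on (\<lambda>i. s ! i) {..<?n}"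
  proof -
    have "distinct s" "length s = ?n" using dist s(1) xs(2) by auto
    then show ?thesis by (auto simp: inj_on_def nth_eq_iff_index_eq)
  qed
  define a :: "nat \<Rightarrow> 'k" where "a i = of_real (w (s ! i))" for i
  have w0: "0 \<le> w i" for i using s(2) by (simp add: weights_def)
  have norm_a: "norm (a i) = w (s ! i)" for i using w0 by (simp add: a_def)
  have "(\<lambda>i. s ! i) ` {..<?n} = set s"
    using nth_image[of ?n s] xs(2) by (simp add: lessThan_atLeast0)
  then have sum_a: "(\<Sum>i<?n. norm (a i)) = 1"
    using s(2) sum.reindex[OF inj, of w] by (simp add: norm_a weights_def)
  have "N (\<lambda>k. \<Sum>i<?n. a i * u i k) \<le> \<delta> + \<theta> * (\<Sum>i<?n. norm (a i))"
  proof (rule block_norm_upper_bound)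
    show "u i \<in> c00" "supp (u i) \<noteq> {}" if "i < ?n" for i using u that by blast+
    show "N (u i) \<le> 1" if "i < ?n" for i
    proof -
      have "\<forall>x\<in>set xs. norm x \<le> 1"
        using xs(1) unfolding T_def l1_block_tree_def l1_tree_def by blast
      then show ?thesis using u(1,2)[OF that] that by (metis norm_\<iota> nth_mem)
    qed
    show "set_less (supp (u i)) (supp (u j))" if "i < j" "j < ?n" for i j
      using sorted_wrt_nth_less[OF admissible_supports[OF xs(1)] that] u(3)[of i] u(3)[of j] that
      by simp
    show "(\<Sum>i\<in>{i. i < ?n \<and> Max (supp (u i)) \<in> F}. norm (a i)) \<le> \<delta>" if F: "F \<in> Sch \<alpha>" for F
    proof -
      let ?I = "{i. i < ?n \<and> Max (supp (u i)) \<in> F}"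
      have "(\<Sum>i\<in>?I. norm (a i)) = sum w ((\<lambda>i. s ! i) ` ?I)"
        unfolding norm_a by (rule sum.reindex[symmetric, unfolded o_def])
          (rule inj_on_subset[OF inj], auto)
      also have "\<dots> \<le> sum w F"
        using regular_finite[OF regular F] w0 m_u by (intro sum_mono2) auto
      also have "\<dots> \<le> \<delta>" using w F by blast
      finally show ?thesis .
    qed
  qed
  also have "\<dots> < 1 / K"
    using \<theta> by (simp add: sum_a K_def \<delta>_def field_simps)
  finally have "N (\<lambda>k. \<Sum>i<?n. a i * u i k) < 1 / K" .
  moreover have "N (\<lambda>k. \<Sum>i<?n. a i * u i k) = norm (\<Sum>i<?n. smul (a i) (xs ! i))"
    using u(1,2) \<iota>_sum[of "{..<?n}" u a] sum_c00[of "{..<?n}" u a] by (simp flip: norm_\<iota>)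
  moreover have "1 / K \<le> norm (\<Sum>i<?n. smul (a i) (xs ! i))"
    using xs(1) sum_a unfolding T_def l1_block_tree_def l1_tree_def by blast
  ultimately show False by simp
qed

text \<open>
  The constant \<open>\<theta>\<^bsup>-n\<^esup>\<close> serves all \<open>\<eta> \<le> \<zeta>\<close> at once, which bounds \<open>SM1\<close> from below by more than \<open>\<zeta>\<close>.
\<close>

lemma tsirelson_P4_vee:
  fixes smul :: "'k::real_normed_field \<Rightarrow> 'x::real_normed_vector \<Rightarrow> 'x"
  assumes \<alpha>: "\<alpha> < omega1" and "tsirelson_space (Sch \<alpha>) \<theta> smul \<iota> X"
    and \<zeta>: "\<zeta> < \<alpha> * ord_of_nat n"
  shows "X \<in> P4_vee smul \<sigma> \<zeta>"
proof -
  interpret tsirelson_space "Sch \<alpha>" \<theta> smul \<iota> X by (rule assms(2))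
  have "0 < n"
  proof (rule ccontr)
    assume "\<not> 0 < n"
    with \<zeta> have "\<zeta> < 0" by (simp add: mult_zero)
    then show False using zero_le_ordinal leD by blast
  qed
  define K where "K = 1 / \<theta> ^ n"
  have "\<theta> ^ n < 1" using \<theta> \<open>0 < n\<close> by (simp add: power_less_one_iff)
  then have K: "1 < K" using \<theta> by (simp add: K_def)
  have n: "ord_of_nat n < omega1"
    by (rule less_trans[OF _ countable_omega]) (auto simp: less_omega_iff)
  have "\<exists>x. l1_spreading_model smul \<sigma> X K \<eta> x" if \<eta>: "\<eta> \<le> \<zeta>" for \<eta>
  proof -
    have le: "\<eta> \<le> \<alpha> * ord_of_nat n" using \<eta> \<zeta> by simp
    have c: "\<alpha> * ord_of_nat n < omega1" by (rule countable_mult[OF \<alpha> n])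
    then have "\<eta> < omega1" using le by simp
    then have fp: "Sch \<eta> \<subseteq> fin_pos" using regular_fin_pos[OF regular_Sch] by blast
    obtain \<phi> :: "nat \<Rightarrow> nat" where \<phi>: "strict_mono \<phi>"
      "\<forall>F\<in>Sch \<eta>. \<phi> ` F \<in> (bracket (Sch \<alpha>) ^^ n) schreier0"
      using embeds_trans[OF embeds_Sch_mono[OF le c] embeds_Sch_mult[OF \<alpha>]] unfolding embeds_def by blast
    show ?thesis
      using basis_l1_spreading_model[OF \<phi>(1) bspec[OF \<phi>(2)] fp] unfolding K_def by blast
  qed
  then have model: "\<exists>x. l1_spreading_model smul \<sigma> X K \<eta> x" if "\<eta> \<le> \<zeta>" for \<eta> using that .
  have "SM1 smul \<sigma> X K > Fin \<zeta>"
  proof (cases "\<exists>\<xi>\<le>omega1. \<nexists>x. l1_spreading_model smul \<sigma> X K \<xi> x")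
    case True
    define \<mu> where "\<mu> = (LEAST \<xi>. \<xi> \<le> omega1 \<and> (\<nexists>x. l1_spreading_model smul \<sigma> X K \<xi> x))"
    have "\<nexists>x. l1_spreading_model smul \<sigma> X K \<mu> x"
      using LeastI_ex[OF True] unfolding \<mu>_def by blast
    then have "\<zeta> < \<mu>" using model[of \<mu>] by (meson linorder_not_le)
    then show ?thesis using True by (simp add: SM1_def \<mu>_def)
  next
    case False
    then show ?thesis unfolding SM1_def by (subst if_not_P) simp_all
  qed
  then show ?thesis
    using K banach unfolding P4_vee_def by blast
qed

end

theorem theorem6p6:
  fixes smul :: "'k::real_normed_field \<Rightarrow> 'x::real_normed_vector \<Rightarrow> 'x"
    and \<sigma> :: "ordinal \<Rightarrow> nat \<Rightarrow> ordinal"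
    and \<theta> :: real
    and \<xi> \<zeta> :: ordinal
    and \<iota> :: "(nat \<Rightarrow> 'k) \<Rightarrow> 'x"
    and X :: "'x set"
  assumes "schreier_choice \<sigma>"
    and "0 < \<theta>" and "\<theta> < 1"
    and "\<xi> < omega1"
    and "omega_pow \<xi> < \<zeta>" and "\<zeta> < omega_pow (\<xi> + 1)"
    and "is_tsirelson_space smul \<sigma> \<theta> (omega_pow \<xi>) \<iota> X"
  shows "X \<in> P4_vee smul \<sigma> \<zeta> \<and>
    (basis_fdd smul (canonical_basis \<iota>), X) \<notin> P2_wedge smul (omega_pow \<xi> + 1)"
proof -
  interpret schreier_families \<sigma> using assms(1) by unfold_locales
  have \<alpha>: "omega_pow \<xi> < omega1" by (rule countable_omega_pow[OF assms(4)])
  have space: "tsirelson_space (Sch (omega_pow \<xi>)) \<theta> smul \<iota> X"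
    using assms(2,3,7) regular_Sch[OF \<alpha>] by unfold_locales (simp_all add: is_tsirelson_space_def)
  obtain n where "\<zeta> < omega_pow \<xi> * ord_of_nat n"
    using less_omega_pow_osucD assms(6) by (auto simp: ordinal_add_1)
  then show ?thesis
    using tsirelson_P4_vee[OF \<alpha> space, of \<zeta> n] tsirelson_not_P2_wedge[OF \<alpha> space]
    by (simp add: ordinal_add_1)
qed

end
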